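(* Let $\Lambda\subset\mathbb{R}^d$ be a repetitive Delone set with finite local complexity. Then $\Lambda$ has $d$ linearly independent topological eigenvalues if and only if $\Lambda$ is topologically conjugate to a Meyer set. In particular, each repetitive Meyer set in $\mathbb{R}^d$ has $d$ linearly independent topological eigenvalues.
   Context: A Delone set $\Lambda\subset\mathbb{R}^d$ is a uniformly discrete and relatively dense set. It has finite local complexity (FLC) if for each $R>0$ there are, up to translation, only finitely many patches $\Lambda\cap B_R(x)$, $x \in \Lambda$. It is repetitive if every patch of $\Lambda$ occurs in $\Lambda$, up to translation, with relatively dense set of locations. The hull $\Omega_\Lambda$ of an FLC Delone set is the closure of $\{\Lambda-x: x\in\mathbb{R}^d\}$ in the usual tiling metric (two point sets are at distance at most $\delta$ if they agree on the ball of radius $1/\delta$ about $0$ up to a translation of size at most $\delta$); it is compact and $\mathbb{R}^d$ acts on it continuously by translation, giving the dynamical system $(\Omega_\Lambda,\mathbb{R}^d)$. A topological eigenvalue of $\Lambda$ is an element $\beta$ of the dual space ${\mathbb{R}^d}^*$ for which there is a non-zero continuous function $f:\Omega_\Lambda\to\mathbb{C}$ with $f(\omega-t)=e^{2\pi i\beta(t)}f(\omega)$ for all $t\in\mathbb{R}^d$, $\omega\in\Omega_\Lambda$. Two Delone sets $\Lambda,\Lambda'$ in $\mathbb{R}^d$ are topologically conjugate if $(\Omega_\Lambda,\mathbb{R}^d)$ and $(\Omega_{\Lambda'},\mathbb{R}^d)$ are topologically conjugate, i.e. there is an $\mathbb{R}^d$-equivariant homeomorphism between the hulls. A Meyer set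 is a relatively dense harmonious subset $\Lambda\subset\mathbb{R}^d$, where harmonious means: for every group homomorphism $\phi$ from the group $\langle\Lambda\rangle$ generated by $\Lambda$ to $S^1$ and every $\epsilon>0$ there is $\beta\in{\mathbb{R}^d}^*$ with $|\phi(a)-e^{2\pi i\beta(a)}|<\epsilon$ for all $a\in\Lambda$. Equivalently, $\Lambda$ is relatively dense and $\Lambda-\Lambda$ is uniformly discrete. Meyer sets are FLC Delone sets. *)

theory Defs
  imports "HOL-Analysis.Analysis" "HOL-Computational_Algebra.Group_Closure"
begin

text \<open>Throughout, \<open>\<real>\<^sup>d\<close> is an arbitrary Euclidean space \<open>'a\<close> with \<open>d = DIM('a)\<close>, its dual
  space is \<open>'a \<Rightarrow>\<^sub>L real\<close>, and \<open>B\<^sub>R(x)\<close> is read as the closed ball.\<close>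

definition translate :: "'a::euclidean_space set \<Rightarrow> 'a \<Rightarrow> 'a set"
  where "translate A t = (\<lambda>x. x - t) ` A"

definition relatively_dense :: "'a::euclidean_space set \<Rightarrow> bool"
  where "relatively_dense A \<longleftrightarrow> (\<exists>R>0. \<forall>x. \<exists>y\<in>A. dist x y \<le> R)"

definition delone :: "'a::euclidean_space set \<Rightarrow> bool"
  where "delone A \<longleftrightarrow> uniform_discrete A \<and> relatively_dense A"

definition patch :: "'a::euclidean_space set \<Rightarrow> real \<Rightarrow> 'a \<Rightarrow> 'a set"
  where "patch A R x = A \<inter> cball x R"

definition FLC :: "'a::euclidean_space set \<Rightarrow> bool"
  where "FLC A \<longleftrightarrow>
    (\<forall>R>0. \<exists>F. finite F \<and> (\<forall>x\<in>A. \<exists>P\<in>F. \<exists>t. patch A R x = translate P t))"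

text \<open>An occurrence of the patch with centre \<open>x\<close> is a vector \<open>t\<close> such that the full patch of the
  same radius around \<open>x + t\<close> is the \<open>t\<close>-translate of the given one (not merely contains it).\<close>

definition repetitive :: "'a::euclidean_space set \<Rightarrow> bool"
  where "repetitive A \<longleftrightarrow>
    (\<forall>R>0. \<forall>x\<in>A. relatively_dense {t. patch A R (x + t) = (\<lambda>y. y + t) ` patch A R x})"

text \<open>The translation of size at most \<open>\<delta>\<close> may be distributed over the two sets, which makes the
  relation symmetric and yields the triangle inequality for the distance below.\<close>

definition agree_upto :: "real \<Rightarrow> 'a::euclidean_space set \<Rightarrow> 'a set \<Rightarrow> bool"
  where "agree_upto \<delta> A B \<longleftrightarrow>
    (\<exists>s t. norm s + norm t \<le> \<delta> \<and>
       translate A s \<inter> cball 0 (1 / \<delta>) = translate B t \<inter> cball 0 (1 / \<delta>))"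

text \<open>The distance is capped at \<open>1\<close>: this keeps the infimum over a nonempty set, and the
  triangle inequality uses it.\<close>

definition tiling_dist :: "'a::euclidean_space set \<Rightarrow> 'a set \<Rightarrow> real"
  where "tiling_dist A B = Inf (insert 1 {\<delta>. 0 < \<delta> \<and> agree_upto \<delta> A B})"

lemma mem_translate_iff: "x \<in> translate A t \<longleftrightarrow> x + t \<in> A"
  by (force simp: translate_def image_iff algebra_simps)

lemma agree_upto_iff:
  "agree_upto \<delta> A B \<longleftrightarrow>
    (\<exists>s t. norm s + norm t \<le> \<delta> \<and> (\<forall>x. norm x \<le> 1 / \<delta> \<longrightarrow> (x + s \<in> A \<longleftrightarrow> x + t \<in> B)))"
  unfolding agree_upto_def by (auto simp: set_eq_iff mem_translate_iff)

lemma agree_upto_commute: "agree_upto \<delta> A B \<Longrightarrow> agree_upto \<delta> B A"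
  unfolding agree_upto_def by (metis add.commute)

lemma agree_upto_triangle:
  fixes A B C :: "'a::euclidean_space set"
  assumes AB: "agree_upto \<delta> A B" and BC: "agree_upto \<epsilon> B C"
    and pos: "0 < \<delta>" "0 < \<epsilon>" and le1: "\<delta> + \<epsilon> \<le> 1"
  shows "agree_upto (\<delta> + \<epsilon>) A C"
proof -
  obtain s t where st: "norm s + norm t \<le> \<delta>"
    "\<And>x. norm x \<le> 1 / \<delta> \<Longrightarrow> x + s \<in> A \<longleftrightarrow> x + t \<in> B"
    using AB unfolding agree_upto_iff by blast
  obtain u v where uv: "norm u + norm v \<le> \<epsilon>"
    "\<And>x. norm x \<le> 1 / \<epsilon> \<Longrightarrow> x + u \<in> B \<longleftrightarrow> x + v \<in> C"
    using BC unfolding agree_upto_iff by blast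
  have aux: "1 / (a + b) + b \<le> 1 / a" if "0 < a" "0 < b" "a + b \<le> 1" for a b :: real
  proof -
    have "a * (a + b) \<le> 1 * 1"
      using that by (intro mult_mono) auto
    then have "b * (a * (a + b)) \<le> b"
      using that mult_left_mono[of "a * (a + b)" 1 b] by simp
    then show ?thesis
      using that by (simp add: field_simps)
  qed
  have "x + (s + u) \<in> A \<longleftrightarrow> x + (t + v) \<in> C" if x: "norm x \<le> 1 / (\<delta> + \<epsilon>)" for x
  proof -
    have nu: "norm u \<le> \<epsilon>"
      using uv(1) norm_ge_zero[of v] by linarith
    have nt: "norm t \<le> \<delta>"
      using st(1) norm_ge_zero[of s] by linarith
    have "norm (x + u) \<le> 1 / \<delta>"
      using norm_triangle_ineq[of x u] x nu aux[of \<delta> \<epsilon>] pos le1 by linarith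
    moreover have "norm (x + t) \<le> 1 / \<epsilon>"
      using norm_triangle_ineq[of x t] x nt aux[of \<epsilon> \<delta>] pos le1 by (simp add: add.commute)
    ultimately show ?thesis
      using st(2)[of "x + u"] uv(2)[of "x + t"] by (simp add: ac_simps)
  qed
  moreover have "norm (s + u) + norm (t + v) \<le> \<delta> + \<epsilon>"
    using norm_triangle_ineq[of s u] norm_triangle_ineq[of t v] st(1) uv(1) by linarith
  ultimately show ?thesis
    unfolding agree_upto_iff by blast
qed

lemma tiling_dist_bdd_below: "bdd_below (insert 1 {\<delta>. 0 < \<delta> \<and> agree_upto \<delta> A B})"
  by (rule bdd_belowI[of _ 0]) auto

lemma tiling_dist_le_1: "tiling_dist A B \<le> 1"
  unfolding tiling_dist_def by (rule cInf_lower[OF _ tiling_dist_bdd_below]) simp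

lemma tiling_dist_leI: "0 < \<delta> \<Longrightarrow> agree_upto \<delta> A B \<Longrightarrow> tiling_dist A B \<le> \<delta>"
  unfolding tiling_dist_def by (rule cInf_lower[OF _ tiling_dist_bdd_below]) simp

lemma tiling_dist_nonneg: "0 \<le> tiling_dist A B"
  unfolding tiling_dist_def by (rule cInf_greatest) auto

lemma tiling_dist_lessE:
  assumes "tiling_dist A B < e" "e \<le> 1"
  obtains \<delta> where "0 < \<delta>" "\<delta> < e" "agree_upto \<delta> A B"
proof -
  have "\<exists>\<delta>\<in>insert 1 {\<delta>. 0 < \<delta> \<and> agree_upto \<delta> A B}. \<delta> < e"
    using assms(1) cInf_less_iff[OF _ tiling_dist_bdd_below, of A B e]
    unfolding tiling_dist_def by blast
  then show thesis
    using that assms(2) by auto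
qed

lemma tiling_dist_zero_subset:
  fixes A B :: "'a::euclidean_space set"
  assumes "tiling_dist A B = 0" "closed B"
  shows "A \<subseteq> B"
proof
  fix a assume a: "a \<in> A"
  have "\<exists>b\<in>B. dist b a < e" if "0 < e" for e
  proof -
    define m where "m = min e (1 / (norm a + 2))"
    have m: "0 < m" "m \<le> 1"
      using that by (auto simp: m_def min_le_iff_disj add_nonneg_pos)
    obtain \<delta> where \<delta>: "0 < \<delta>" "\<delta> < m" "agree_upto \<delta> A B"
      using tiling_dist_lessE[of A B m] assms(1) m by auto
    obtain s t where st: "norm s + norm t \<le> \<delta>"
      "\<And>x. norm x \<le> 1 / \<delta> \<Longrightarrow> x + s \<in> A \<longleftrightarrow> x + t \<in> B"
      using \<delta>(3) unfolding agree_upto_iff by blast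
    have "\<delta> < 1 / (norm a + 2)"
      using \<delta>(2) by (simp add: m_def)
    then have "norm a + 2 \<le> 1 / \<delta>"
      using \<delta>(1) by (simp add: field_simps add_nonneg_pos)
    moreover have "norm s \<le> 1"
      using st(1) \<delta>(2) m(2) norm_ge_zero[of t] by linarith
    ultimately have "norm (a - s) \<le> 1 / \<delta>"
      using norm_triangle_ineq4[of a s] by linarith
    then have "a - s + t \<in> B"
      using st(2)[of "a - s"] a by simp
    moreover have "dist (a - s + t) a < e"
      using norm_triangle_ineq4[of t s] st(1) \<delta>(2) by (simp add: dist_norm m_def)
    ultimately show ?thesis by blast
  qed
  then show "a \<in> B"
    using assms(2) closure_approachable[of a B] closure_closed[of B] by blast
qed

lemma tiling_dist_commute: "tiling_dist A B = tiling_dist B A"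
proof -
  have "{\<delta>. 0 < \<delta> \<and> agree_upto \<delta> A B} = {\<delta>. 0 < \<delta> \<and> agree_upto \<delta> B A}"
    using agree_upto_commute by blast
  then show ?thesis
    by (simp add: tiling_dist_def)
qed

lemma tiling_dist_refl: "tiling_dist A A = 0"
proof (rule antisym[OF _ tiling_dist_nonneg])
  have "agree_upto \<delta> A A" if "0 < \<delta>" for \<delta>
    unfolding agree_upto_iff using that by (intro exI[of _ 0]) auto
  then have "tiling_dist A A \<le> \<delta>" if "0 < \<delta>" for \<delta>
    using that tiling_dist_leI by blast
  then show "tiling_dist A A \<le> 0"
    by (rule field_le_epsilon) simp
qed

lemma tiling_dist_triangle: "tiling_dist A C \<le> tiling_dist A B + tiling_dist B C"
proof (rule ccontr)
  assume "\<not> ?thesis"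
  then have *: "tiling_dist A B + tiling_dist B C < tiling_dist A C"
    by simp
  define g where "g = (tiling_dist A C - tiling_dist A B - tiling_dist B C) / 2"
  have g: "0 < g" "tiling_dist A B + tiling_dist B C + 2 * g = tiling_dist A C"
    using * by (auto simp: g_def field_simps)
  have "tiling_dist A B + g \<le> 1" "tiling_dist B C + g \<le> 1"
    using g tiling_dist_le_1[of A C] tiling_dist_nonneg[of A B] tiling_dist_nonneg[of B C]
    by linarith+
  then obtain \<delta> \<epsilon> where d: "0 < \<delta>" "\<delta> < tiling_dist A B + g" "agree_upto \<delta> A B"
    and e: "0 < \<epsilon>" "\<epsilon> < tiling_dist B C + g" "agree_upto \<epsilon> B C"
    using tiling_dist_lessE[of A B "tiling_dist A B + g"]
      tiling_dist_lessE[of B C "tiling_dist B C + g"] g(1) by (metis less_add_same_cancel1)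
  have lt: "\<delta> + \<epsilon> < tiling_dist A C"
    using d(2) e(2) g(2) by linarith
  then have "agree_upto (\<delta> + \<epsilon>) A C"
    using agree_upto_triangle d(1,3) e(1,3) tiling_dist_le_1[of A C] by fastforce
  then have "tiling_dist A C \<le> \<delta> + \<epsilon>"
    using tiling_dist_leI[of "\<delta> + \<epsilon>" A C] d(1) e(1) by simp
  with lt show False by simp
qed

text \<open>The ambient space of the hulls consists of all closed sets; Delone sets are closed.\<close>

interpretation tiling: Metric_space "Collect closed :: 'a::euclidean_space set set" tiling_dist
proof
  fix A B :: "'a set" assume "A \<in> Collect closed" "B \<in> Collect closed"
  then show "tiling_dist A B = 0 \<longleftrightarrow> A = B"
    using tiling_dist_zero_subset[of A B] tiling_dist_zero_subset[of B A]
      tiling_dist_commute[of A B] tiling_dist_refl by auto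
qed (use tiling_dist_nonneg tiling_dist_commute tiling_dist_triangle in auto)

definition hull_of :: "'a::euclidean_space set \<Rightarrow> 'a set set"
  where "hull_of A = tiling.mtopology closure_of (range (translate A))"

definition hull_topology :: "'a::euclidean_space set \<Rightarrow> 'a set topology"
  where "hull_topology A = subtopology tiling.mtopology (hull_of A)"

definition topological_eigenvalue ::
    "'a::euclidean_space set \<Rightarrow> ('a \<Rightarrow>\<^sub>L real) \<Rightarrow> bool"
  where "topological_eigenvalue A \<beta> \<longleftrightarrow>
    (\<exists>f :: 'a set \<Rightarrow> complex.
       continuous_map (hull_topology A) euclidean f \<and>
       (\<exists>\<omega>\<in>hull_of A. f \<omega> \<noteq> 0) \<and>
       (\<forall>t. \<forall>\<omega>\<in>hull_of A.
          f (translate \<omega> t) = exp (2 * of_real pi * \<i> * of_real (blinfun_apply \<beta> t)) * f \<omega>))"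

definition has_full_rank_eigenvalues :: "'a::euclidean_space set \<Rightarrow> bool"
  where "has_full_rank_eigenvalues A \<longleftrightarrow>
    (\<exists>S. S \<subseteq> Collect (topological_eigenvalue A) \<and> independent S \<and> finite S \<and> card S = DIM('a))"

definition topologically_conjugate ::
    "'a::euclidean_space set \<Rightarrow> 'a set \<Rightarrow> bool"
  where "topologically_conjugate A B \<longleftrightarrow>
    (\<exists>h. homeomorphic_map (hull_topology A) (hull_topology B) h \<and>
       (\<forall>t. \<forall>\<omega>\<in>hull_of A. h (translate \<omega> t) = translate (h \<omega>) t))"

text \<open>\<open>group_closure A\<close> is the additive subgroup generated by \<open>A\<close>.\<close>

definition harmonious :: "'a::euclidean_space set \<Rightarrow> bool"
  where "harmonious A \<longleftrightarrow>
    (\<forall>\<phi> :: 'a \<Rightarrow> complex.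
       (\<forall>a\<in>group_closure A. \<phi> a \<in> sphere 0 1) \<and>
       (\<forall>a\<in>group_closure A. \<forall>b\<in>group_closure A. \<phi> (a + b) = \<phi> a * \<phi> b) \<longrightarrow>
       (\<forall>\<epsilon>>0. \<exists>\<beta> :: 'a \<Rightarrow>\<^sub>L real. \<forall>a\<in>A.
          norm (\<phi> a - exp (2 * of_real pi * \<i> * of_real (blinfun_apply \<beta> a))) < \<epsilon>))"

definition meyer :: "'a::euclidean_space set \<Rightarrow> bool"
  where "meyer A \<longleftrightarrow> relatively_dense A \<and> harmonious A"

end

theory Submission
  imports Defs
begin

text \<open>
  For a repetitive set \<open>\<Lambda>\<close>, a functional \<open>\<beta>\<close> is an eigenvalue iff \<open>\<beta>\<close> is close to an integer on all
  vectors by which a sufficiently large patch of \<open>\<Lambda>\<close> recurs.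

  If \<open>\<Lambda>\<close> is harmonious, a Baire argument in the compact dual of the group generated by \<open>\<Lambda>\<close> shows
  that the functionals which are nearly integral on all of \<open>\<Lambda>\<close> are relatively dense in the dual
  space. For such a functional the small fractional part on \<open>\<Lambda>\<close> is a bounded real function whose
  increments depend only on the displacement; a copy of a patch on which it nearly attains both its
  supremum and its infimum lies near every point, so it nearly agrees at equal patches, and the
  functional is an eigenvalue. Every point of the hull of a repetitive set is almost periodic, so
  repetitivity passes to a conjugate Meyer set, and eigenvalues pull back.

  Conversely, \<open>d\<close> independent eigenvalues define a lattice \<open>L\<close> such that recurrence vectors of
  large patches are close to \<open>L\<close>. There are finitely many patches of a fixed large radius, and the
  points of \<open>\<Lambda>\<close> with a given patch are close to a single translate of \<open>L\<close>. Moving each point into a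
  coset of \<open>L\<close> in a finer lattice, a different coset for every patch, yields a conjugate set that
  lies in a lattice.
\<close>

section \<open>The tiling metric\<close>

text \<open>On the orbit of \<open>A\<close> an eigenfunction is a multiple of
  \<open>t \<mapsto> circ (\<beta> t)\<close>, so the question is whether that function is
  continuous for the tiling metric and extends. Closeness in this metric is exact agreement of
  patches after two small translations. Hence eigenvalues and conjugacies alike are tested on pairs
  \<open>u\<close>, \<open>v\<close> with equal patches (\<open>alike\<close>), and extension by
  uniform continuity does the rest. Harmonicity yields one functional per character with no bound on
  its norm; Baire bounds it on an open set of characters, and a finite net spreads the bound. A
  conjugacy matches \<Lambda>' with some point of the hull of \<Lambda>, perhaps outside the orbit,
  so recurrence is required of every hull point. The coding must be readable in both directions from
  bounded neighbourhoods, although displacements between equal patches of \<Lambda> are only close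
  to \<open>L\<close> while those of the code lie exactly in \<open>L\<close>. Separation of
  \<open>L\<close> removes the error in one direction, uniform discreteness of \<Lambda> in the
  other.\<close>

lemma translate_translate [simp]: "translate (translate A s) t = translate A (s + t)"
  by (auto simp: set_eq_iff mem_translate_iff add_ac)

lemma translate_0 [simp]: "translate A 0 = A"
  by (auto simp: set_eq_iff mem_translate_iff)

lemma closed_translate: "closed A \<Longrightarrow> closed (translate A t)"
  unfolding translate_def using closed_translation_subtract[of A t] by simp

lemma agree_upto_mono:
  assumes "agree_upto \<delta> A B" "0 < \<delta>" "\<delta> \<le> \<epsilon>"
  shows "agree_upto \<epsilon> A B"
proof -
  obtain s t where st: "norm s + norm t \<le> \<delta>"
    "\<And>x. norm x \<le> 1 / \<delta> \<Longrightarrow> x + s \<in> A \<longleftrightarrow> x + t \<in> B"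
    using assms(1) unfolding agree_upto_iff by blast
  have "1 / \<epsilon> \<le> 1 / \<delta>"
    using assms(2,3) by (intro divide_left_mono) auto
  then show ?thesis
    unfolding agree_upto_iff using st assms(3) by (meson order_trans)
qed

lemma tiling_dist_less_agree:
  assumes "tiling_dist A B < e" "e \<le> 1"
  shows "agree_upto e A B"
  using assms by (metis agree_upto_mono less_imp_le tiling_dist_lessE)

lemma tiling_dist_translate_self: "tiling_dist A (translate A w) \<le> norm w"
proof (cases "w = 0")
  case False
  have "agree_upto (norm w) A (translate A w)"
    unfolding agree_upto_iff by (rule exI[of _ w], rule exI[of _ 0]) (auto simp: mem_translate_iff)
  then show ?thesis
    using False by (intro tiling_dist_leI) auto
qed (simp add: tiling_dist_refl)

text \<open>Translation does not preserve the metric, which looks at a ball about the origin. The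
  ball of radius \<open>2 / \<epsilon>\<close>, shifted by any \<open>r\<close> of norm at most
  \<open>K\<close>, must fit inside the ball of radius \<open>1 / \<delta>\<close>; this is the
  origin of \<open>2 / \<epsilon> + \<bar>K\<bar>\<close>.\<close>

lemma tiling_dist_translate_small:
  fixes K \<epsilon> :: real
  assumes "0 < \<epsilon>"
  shows "\<exists>\<delta>>0. \<forall>(A::'a::euclidean_space set) B r. norm r \<le> K \<longrightarrow> tiling_dist A B < \<delta> \<longrightarrow>
    tiling_dist (translate A r) (translate B r) < \<epsilon>"
proof -
  define \<delta> where "\<delta> = min 1 (min (\<epsilon> / 2) (1 / (2 / \<epsilon> + \<bar>K\<bar>)))"
  have pos: "0 < 2 / \<epsilon> + \<bar>K\<bar>"
    using assms by (simp add: add_pos_nonneg)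
  have \<delta>: "0 < \<delta>" "\<delta> \<le> 1" "\<delta> \<le> \<epsilon> / 2" "\<delta> \<le> 1 / (2 / \<epsilon> + \<bar>K\<bar>)"
    using assms pos by (auto simp: \<delta>_def)
  have inv: "2 / \<epsilon> + \<bar>K\<bar> \<le> 1 / \<delta>"
    using \<delta>(1,4) pos by (simp add: field_simps)
  have "tiling_dist (translate A r) (translate B r) < \<epsilon>"
    if r: "norm r \<le> K" and AB: "tiling_dist A B < \<delta>" for A B :: "'a set" and r
  proof -
    obtain s t where st: "norm s + norm t \<le> \<delta>"
      "\<And>x. norm x \<le> 1 / \<delta> \<Longrightarrow> x + s \<in> A \<longleftrightarrow> x + t \<in> B"
      using tiling_dist_less_agree[OF AB \<delta>(2)] unfolding agree_upto_iff by blast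
    have "x + s + r \<in> A \<longleftrightarrow> x + t + r \<in> B" if "norm x \<le> 1 / (\<epsilon> / 2)" for x
    proof -
      have "norm (x + r) \<le> 1 / \<delta>"
        using norm_triangle_ineq[of x r] that r inv by auto
      then show ?thesis
        using st(2)[of "x + r"] by (simp add: add_ac)
    qed
    then have "agree_upto (\<epsilon> / 2) (translate A r) (translate B r)"
      unfolding agree_upto_iff mem_translate_iff using st(1) \<delta>(3) by (meson order_trans)
    then have "tiling_dist (translate A r) (translate B r) \<le> \<epsilon> / 2"
      using assms by (intro tiling_dist_leI) auto
    then show ?thesis
      using assms by simp
  qed
  then show ?thesis
    using \<delta>(1) by blast
qed

section \<open>Exact coincidence of patches\<close>

text \<open>The centres are arbitrary points of the space, not only points of \<open>A\<close>, so
  patches can be recentred freely (\<open>alike_shift\<close>).\<close>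

definition alike :: "'a::euclidean_space set \<Rightarrow> real \<Rightarrow> 'a \<Rightarrow> 'a \<Rightarrow> bool"
  where "alike A R u v \<longleftrightarrow> (\<forall>x. norm x \<le> R \<longrightarrow> (x + u \<in> A \<longleftrightarrow> x + v \<in> A))"

lemma alikeD: "alike A R u v \<Longrightarrow> norm x \<le> R \<Longrightarrow> x + u \<in> A \<longleftrightarrow> x + v \<in> A"
  by (simp add: alike_def)

lemma alike_at: "alike A R u v \<Longrightarrow> norm (x - u) \<le> R \<Longrightarrow> x \<in> A \<longleftrightarrow> x + (v - u) \<in> A"
  using alikeD[of A R u v "x - u"] by (simp add: algebra_simps)

lemma alike_sym: "alike A R u v \<Longrightarrow> alike A R v u"
  by (auto simp: alike_def)

lemma alike_trans: "alike A R u v \<Longrightarrow> alike A R v w \<Longrightarrow> alike A R u w"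
  by (auto simp: alike_def)

lemma alike_mono: "alike A R u v \<Longrightarrow> r \<le> R \<Longrightarrow> alike A r u v"
  by (auto simp: alike_def)

lemma alike_shift:
  assumes "alike A R u v" "r + norm w \<le> R"
  shows "alike A r (u + w) (v + w)"
  unfolding alike_def
proof (intro allI impI)
  fix x :: 'a assume "norm x \<le> r"
  then have "norm (x + w) \<le> R"
    using assms(2) norm_triangle_ineq[of x w] by linarith
  then show "x + (u + w) \<in> A \<longleftrightarrow> x + (v + w) \<in> A"
    using alikeD[OF assms(1), of "x + w"] by (simp add: add_ac)
qed

lemma alike_imp_tiling_dist:
  assumes "alike A R u v" "0 < R"
  shows "tiling_dist (translate A u) (translate A v) \<le> 1 / R"
proof (rule tiling_dist_leI)
  show "agree_upto (1 / R) (translate A u) (translate A v)"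
    unfolding agree_upto_iff mem_translate_iff
    using assms by (intro exI[of _ 0]) (auto simp: alike_def)
qed (use assms in simp)

text \<open>Only a partial converse of \<open>alike_imp_tiling_dist\<close> is possible: the metric
  tolerates two small shifts, and these have to be paid for here.\<close>

lemma tiling_dist_imp_alike:
  assumes "tiling_dist (translate A u) (translate A v) < e" "e \<le> 1"
  obtains s t where "norm s + norm t \<le> e" "alike A (1 / e) (u + s) (v + t)"
proof -
  obtain s t where st: "norm s + norm t \<le> e"
    "\<And>x. norm x \<le> 1 / e \<Longrightarrow> x + s + u \<in> A \<longleftrightarrow> x + t + v \<in> A"
    using tiling_dist_less_agree[OF assms] unfolding agree_upto_iff mem_translate_iff by blast
  then have "alike A (1 / e) (u + s) (v + t)"
    by (simp add: alike_def add_ac)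
  with st(1) show thesis by (rule that)
qed

text \<open>Makes maps into a hull extendable from an orbit. Along a fast subsequence the shifts
  that align consecutive sets are summable, so the sets realigned by the partial sums
  \<open>W n\<close> stabilise on growing balls; the limit is the stable set \<open>B\<close> moved
  by the total shift \<open>V\<close>.\<close>

lemma tiling_mcomplete: "Metric_space.mcomplete (Collect closed :: 'a::euclidean_space set set) tiling_dist"
  unfolding tiling.mcomplete_def
proof (intro allI impI)
  fix \<sigma> :: "nat \<Rightarrow> 'a set"
  assume C: "tiling.MCauchy \<sigma>"
  have cl: "closed (\<sigma> n)" for n
    using C by (auto simp: tiling.MCauchy_def)
  have "\<exists>N. \<forall>m\<ge>N. \<forall>n\<ge>N. tiling_dist (\<sigma> m) (\<sigma> n) < (1/2) ^ k" for k
    using C unfolding tiling.MCauchy_def by (meson zero_less_power zero_less_divide_1_iff zero_less_numeral)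
  then obtain N where N: "\<And>k m n. N k \<le> m \<Longrightarrow> N k \<le> n \<Longrightarrow> tiling_dist (\<sigma> m) (\<sigma> n) < (1/2) ^ k"
    by metis
  define r where "r k = k + (\<Sum>i\<le>k. N i)" for k
  have r: "strict_mono r"
    by (rule strict_monoI_Suc) (simp add: r_def)
  have rN: "N k \<le> r k" for k
    unfolding r_def by (rule trans_le_add2, rule member_le_sum) auto
  define A where "A k = \<sigma> (r k)" for k
  have "agree_upto ((1/2)^k) (A k) (A (Suc k))" for k
  proof (rule tiling_dist_less_agree)
    have "N k \<le> r (Suc k)"
      using rN[of k] strict_monoD[OF r, of k "Suc k"] by simp
    then show "tiling_dist (A k) (A (Suc k)) < (1/2)^k"
      unfolding A_def using rN N by blast
  qed (simp add: power_le_one)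
  then obtain s t where st: "\<And>k. norm (s k) + norm (t k) \<le> (1/2) ^ k"
    "\<And>k x. norm x \<le> 2 ^ k \<Longrightarrow> x + s k \<in> A k \<longleftrightarrow> x + t k \<in> A (Suc k)"
    unfolding agree_upto_iff by (simp add: power_one_over) metis
  define w where "w k = t k - s k" for k
  define W where "W n = (\<Sum>k<n. w k)" for n
  have w: "norm (w k) \<le> (1/2) ^ k" for k
    unfolding w_def using norm_triangle_ineq4[of "t k" "s k"] st(1)[of k] by linarith
  have sw: "summable (\<lambda>k. (1/2::real) ^ k)"
    by (simp add: summable_geometric)
  then have nw: "summable (\<lambda>k. norm (w k))"
    using w by (intro summable_comparison_test'[OF sw, of 0]) auto
  then have sumw: "summable w"
    by (rule summable_norm_cancel)
  define V where "V = suminf w"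
  have VW: "norm (V - W n) \<le> 2 * (1/2) ^ n" for n
  proof -
    have nw': "summable (\<lambda>k. norm (w (k + n)))"
      using nw summable_iff_shift[of "\<lambda>k. norm (w k)" n] by blast
    have sw': "summable (\<lambda>k. (1/2::real) ^ (k + n))"
      using sw summable_iff_shift[of "\<lambda>k. (1/2::real) ^ k" n] by blast
    have "V - W n = (\<Sum>k. w (k + n))"
      unfolding V_def W_def using suminf_minus_initial_segment[OF sumw, of n] by simp
    also have "norm \<dots> \<le> (\<Sum>k. norm (w (k + n)))"
      using nw' by (rule summable_norm)
    also have "\<dots> \<le> (\<Sum>k. (1/2) ^ (k + n))"
      using nw' sw' w by (intro suminf_le) auto
    also have "\<dots> = 2 * (1/2) ^ n"
      by (simp add: power_add suminf_mult2[symmetric] sw suminf_geometric)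
    finally show ?thesis .
  qed
  have nV: "norm V \<le> 2"
    using VW[of 0] by (simp add: W_def)
  have nW: "norm (W n) \<le> 4" for n
  proof -
    have "(1/2::real) ^ n \<le> 1" by (simp add: power_le_one)
    then show ?thesis
      using VW[of n] nV norm_triangle_ineq4[of V "V - W n"] by simp
  qed
  \<comment> \<open>The \<open>5\<close> pays for \<open>norm (W n) \<le> 4\<close> and
    \<open>norm (s n) \<le> 1\<close>, keeping the argument in the ball on which \<open>s n\<close>
    and \<open>t n\<close> align the two sets.\<close>
  have step1: "z + W n \<in> A n \<longleftrightarrow> z + W (Suc n) \<in> A (Suc n)" if "norm z \<le> 2 ^ n - 5" for z n
  proof -
    have "norm (s n) \<le> 1"
      using st(1)[of n] norm_ge_zero[of "t n"] power_le_one[of "1/2::real" n] by linarith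
    then have "norm (z + W n - s n) \<le> 2 ^ n"
      using that nW[of n] norm_triangle_ineq[of z "W n"] norm_triangle_ineq4[of "z + W n" "s n"]
      by linarith
    from st(2)[OF this] show ?thesis
      by (simp add: W_def w_def algebra_simps)
  qed
  define B where "B = {z. \<exists>N. \<forall>n\<ge>N. z + W n \<in> A n}"
  have stable: "z + W n \<in> A n \<longleftrightarrow> z + W m \<in> A m" if "norm z \<le> 2 ^ n - 5" "n \<le> m" for z n m
    using that(2)
  proof (induction m rule: dec_induct)
    case (step m)
    have "(2::real) ^ n \<le> 2 ^ m"
      using step.hyps by (intro power_increasing) auto
    then have "norm z \<le> 2 ^ m - 5"
      using that(1) by linarith
    then show ?case
      using step.IH step1[of z m] by blast
  qed simp
  have B: "z \<in> B \<longleftrightarrow> z + W n \<in> A n" if "norm z \<le> 2 ^ n - 5" for z n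
    unfolding B_def mem_Collect_eq using stable[OF that] by (meson le_cases)
  \<comment> \<open>The \<open>7\<close> exceeds the \<open>5\<close> of \<open>step1\<close> by the
    bound \<open>2\<close> on \<open>norm V\<close>, so that a shift by \<open>V\<close> stays in
    range.\<close>
  have big: "\<exists>n. C \<le> 2 ^ n - 7" for C :: real
  proof -
    obtain n where "C + 7 < 2 ^ n"
      using real_arch_pow[of 2 "C + 7"] by auto
    then have "C \<le> 2 ^ n - 7"
      by linarith
    then show ?thesis ..
  qed
  \<comment> \<open>A convergent sequence is bounded, and on a bounded region \<open>B\<close>
    coincides with one closed set \<open>translate (A n) (W n)\<close>.\<close>
  have "closed B"
  unfolding closed_sequential_limits
  proof (intro allI impI, elim conjE)
    fix x l assume x: "\<forall>n. x n \<in> B" "x \<longlonglongrightarrow> l"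
    obtain C where C: "\<And>k. norm (x k) \<le> C"
      using convergent_imp_Bseq[of x] x(2) by (auto simp: convergent_def Bseq_def)
    obtain n where n: "C \<le> 2 ^ n - 7"
      using big by blast
    have "x k + W n \<in> A n" for k
      using B[of "x k" n] x(1) C[of k] n by auto
    moreover have "(\<lambda>k. x k + W n) \<longlonglongrightarrow> l + W n"
      using x(2) by (intro tendsto_intros)
    ultimately have "l + W n \<in> A n"
      using closed_sequentially[OF cl[of "r n"], of "\<lambda>k. x k + W n" "l + W n"] by (simp add: A_def)
    moreover have "norm l \<le> C"
      using x(2) C by (intro LIMSEQ_le_const2[of "\<lambda>k. norm (x k)"] tendsto_norm) auto
    ultimately show "l \<in> B"
      using B[of l n] n by auto
  qed
  define D where "D = translate B (- V)"
  have "closed D"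
    unfolding D_def using \<open>closed B\<close> by (rule closed_translate)
  have lim: "\<exists>N. \<forall>n\<ge>N. tiling_dist (A n) D < e" if "0 < e" for e
  proof -
    obtain n0 where n0: "2 / e + 1 \<le> 2 ^ n0 - 7"
      using big by blast
    obtain n1 where n1: "4 / e \<le> 2 ^ n1 - 7"
      using big by blast
    have "tiling_dist (A n) D < e" if "max n0 n1 \<le> n" for n
    proof -
      have p: "(2::real) ^ n0 \<le> 2 ^ n" "(2::real) ^ n1 \<le> 2 ^ n"
        using that by (auto intro!: power_increasing)
      have "2 * (1/2) ^ n \<le> e / 2"
      proof -
        have "4 / e \<le> 2 ^ n"
          using n1 p(2) by linarith
        then show ?thesis
          using \<open>0 < e\<close> by (simp add: field_simps power_one_over)
      qed
      then have "norm (W n - V) + norm (0::'a) \<le> e / 2"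
        using VW[of n] by (simp add: norm_minus_commute)
      moreover have "x + (W n - V) \<in> A n \<longleftrightarrow> x + 0 \<in> D" if "norm x \<le> 1 / (e / 2)" for x
      proof -
        have "norm (x - V) \<le> 2 ^ n - 5"
        proof -
          have "norm x \<le> 2 / e"
            using that by simp
          then show ?thesis
            using nV norm_triangle_ineq4[of x V] n0 p(1) by linarith
        qed
        from B[OF this] show ?thesis
          by (simp add: D_def mem_translate_iff algebra_simps)
      qed
      ultimately have "agree_upto (e / 2) (A n) D"
        unfolding agree_upto_iff by blast
      then have "tiling_dist (A n) D \<le> e / 2"
        using \<open>0 < e\<close> by (intro tiling_dist_leI) auto
      then show ?thesis
        using \<open>0 < e\<close> by simp
    qed
    then show ?thesis by blast
  qed
  have "limitin tiling.mtopology (\<sigma> \<circ> r) D sequentially"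
    unfolding tiling.limit_metric_sequentially
    using lim \<open>closed D\<close> cl by (auto simp: A_def)
  then show "\<exists>x. limitin tiling.mtopology \<sigma> x sequentially"
    using tiling.MCauchy_convergent_subsequence[OF C r] by blast
qed

section \<open>Hulls as orbit closures\<close>

lemma hull_subset_closed: "hull_of A \<subseteq> Collect closed"
  unfolding hull_of_def using closure_of_subset_topspace[of tiling.mtopology] by simp

lemma topspace_hull [simp]: "topspace (hull_topology A) = hull_of A"
  unfolding hull_topology_def using hull_subset_closed by (auto simp: topspace_subtopology)

lemma translate_in_hull: "closed A \<Longrightarrow> translate A t \<in> hull_of A"
  unfolding hull_of_def
  using closure_of_subset[of "range (translate A)" tiling.mtopology] closed_translate by fastforce

lemma in_hull_iff:
  assumes "closed A"
  shows "\<omega> \<in> hull_of A \<longleftrightarrow> closed \<omega> \<and> (\<forall>e>0. \<exists>t. tiling_dist (translate A t) \<omega> < e)"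
  unfolding hull_of_def tiling.metric_closure_of tiling.mball_def
  using assms closed_translate[OF assms] by (auto simp: tiling_dist_commute)

lemma hull_approx:
  assumes "closed A" "\<omega> \<in> hull_of A" "0 < e"
  obtains t where "tiling_dist (translate A t) \<omega> < e"
  using assms in_hull_iff by blast

lemma translate_hull_closed:
  assumes "closed A" "\<omega> \<in> hull_of A"
  shows "translate \<omega> t \<in> hull_of A"
  unfolding in_hull_iff[OF assms(1)]
proof (intro conjI allI impI)
  show "closed (translate \<omega> t)"
    using assms in_hull_iff closed_translate by blast
  fix e :: real assume "0 < e"
  then obtain \<delta> where \<delta>: "0 < \<delta>" "\<forall>(A::'a set) B r. norm r \<le> norm t \<longrightarrow> tiling_dist A B < \<delta> \<longrightarrow>
    tiling_dist (translate A r) (translate B r) < e"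
    using tiling_dist_translate_small[of e "norm t"] by blast
  obtain s where "tiling_dist (translate A s) \<omega> < \<delta>"
    using hull_approx[OF assms \<delta>(1)] .
  then have "tiling_dist (translate (translate A s) t) (translate \<omega> t) < e"
    using \<delta>(2) by blast
  then show "\<exists>s. tiling_dist (translate A s) (translate \<omega> t) < e"
    unfolding translate_translate by blast
qed

lemma continuous_map_hull_into_tiling_iff:
  assumes "h \<in> hull_of A \<rightarrow> Collect closed"
  shows "continuous_map (hull_topology A) tiling.mtopology h \<longleftrightarrow>
    (\<forall>\<omega>\<in>hull_of A. \<forall>e>0. \<exists>\<delta>>0. \<forall>\<omega>'\<in>hull_of A. tiling_dist \<omega> \<omega>' < \<delta> \<longrightarrow> tiling_dist (h \<omega>) (h \<omega>') < e)"
proof -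
  interpret H: Submetric "Collect closed :: 'a set set" tiling_dist "hull_of A"
    by unfold_locales (rule hull_subset_closed)
  show ?thesis
    unfolding hull_topology_def
    using assms tiling.Metric_space_axioms H.sub.Metric_space_axioms
    by (simp add: H.mtopology_submetric[symmetric] H.sub.metric_continuous_map[OF tiling.Metric_space_axioms]
        image_subset_iff Pi_iff Ball_def imp_conjL)
qed

lemma continuous_map_translate:
  assumes "closed A"
  shows "continuous_map (hull_topology A) (hull_topology A) (\<lambda>\<omega>. translate \<omega> t)"
proof -
  have "continuous_map (hull_topology A) tiling.mtopology (\<lambda>\<omega>. translate \<omega> t)"
  proof (subst continuous_map_hull_into_tiling_iff)
    show "(\<lambda>\<omega>. translate \<omega> t) \<in> hull_of A \<rightarrow> Collect closed"
      using hull_subset_closed closed_translate by blast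
    show "\<forall>\<omega>\<in>hull_of A. \<forall>e>0. \<exists>\<delta>>0. \<forall>\<omega>'\<in>hull_of A. tiling_dist \<omega> \<omega>' < \<delta> \<longrightarrow>
      tiling_dist (translate \<omega> t) (translate \<omega>' t) < e"
      using tiling_dist_translate_small[of _ "norm t"] by (metis order_refl)
  qed
  then show ?thesis
    using translate_hull_closed[OF assms]
    by (simp add: hull_topology_def continuous_map_in_subtopology image_subset_iff Pi_iff
        topspace_subtopology)
qed

lemma orbit_dense:
  assumes "closed A"
  shows "hull_of A = hull_topology A closure_of range (translate A)"
proof -
  have "range (translate A) \<subseteq> hull_of A"
    using translate_in_hull[OF assms] by blast
  then show ?thesis
    by (simp add: hull_topology_def closure_of_subtopology Int_absorb1 hull_of_def[symmetric])
qed

text \<open>\<open>F\<close> is given in terms of \<open>t\<close> but must depend only on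
  \<open>translate A t\<close>, and \<open>A\<close> may have periods. Uniformity settles this as
  well: equal translates are at distance \<open>0\<close>, so their values are closer than every
  bound.\<close>

lemma extend_from_orbit:
  fixes A :: "'a::euclidean_space set" and m :: "'b metric"
  assumes cl: "closed A" and comp: "mcomplete_of m" and into: "\<And>t. F t \<in> mspace m"
    and unif: "\<And>e. 0 < e \<Longrightarrow> \<exists>\<delta>>0. \<forall>s t. tiling_dist (translate A s) (translate A t) < \<delta> \<longrightarrow> mdist m (F s) (F t) < e"
  obtains f where "continuous_map (hull_topology A) (mtopology_of m) f" "\<And>t. f (translate A t) = F t"
proof -
  have wd: "F s = F t" if "translate A s = translate A t" for s t
  proof (rule ccontr)
    assume "F s \<noteq> F t"
    then have "0 < mdist m (F s) (F t)"
      by (intro Metric_space.mdist_pos_less[OF Metric_space_mspace_mdist] into)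
    then obtain \<delta> where "0 < \<delta>"
      "\<And>s' t'. tiling_dist (translate A s') (translate A t') < \<delta> \<Longrightarrow> mdist m (F s') (F t') < mdist m (F s) (F t)"
      using unif by blast
    from this(2)[of s t] this(1) show False
      using that tiling_dist_refl[of "translate A t"] by simp
  qed
  define g where "g \<omega> = F (SOME t. \<omega> = translate A t)" for \<omega>
  have g: "g (translate A t) = F t" for t
    unfolding g_def by (rule wd[symmetric], rule someI[of _ t]) simp
  let ?M = "metric (Collect closed :: 'a set set, tiling_dist)"
  have "uniformly_continuous_map (submetric ?M (range (translate A))) m g"
    unfolding uniformly_continuous_map_def
  proof (intro conjI allI impI)
    show "g \<in> mspace (submetric ?M (range (translate A))) \<rightarrow> mspace m"
      using g into by auto
    fix e :: real assume "0 < e"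
    then obtain \<delta> where "0 < \<delta>" "\<forall>s t. tiling_dist (translate A s) (translate A t) < \<delta> \<longrightarrow> mdist m (F s) (F t) < e"
      using unif by blast
    then show "\<exists>\<delta>>0. \<forall>x\<in>mspace (submetric ?M (range (translate A))).
      \<forall>y\<in>mspace (submetric ?M (range (translate A))).
        mdist (submetric ?M (range (translate A))) y x < \<delta> \<longrightarrow> mdist m (g y) (g x) < e"
      by (intro exI[of _ \<delta>]) (auto simp: g)
  qed
  then have "\<exists>f. continuous_map (subtopology (mtopology_of ?M) (mtopology_of ?M closure_of range (translate A))) (mtopology_of m) f \<and>
      (\<forall>x\<in>range (translate A). f x = g x)"
    by (rule Cauchy_continuous_map_extends_to_continuous_closure_of[OF comp uniformly_imp_Cauchy_continuous_map]) blast
  then show thesis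
    using that g by (auto simp: hull_topology_def hull_of_def)
qed

text \<open>Going from \<open>s\<close> to \<open>t\<close> takes a small shift, an exact
  coincidence of patches and another small shift, each costing less than \<open>e / 3\<close>.
  Serves both circle-valued functions and translates of a second set.\<close>

lemma uniform_on_orbit:
  fixes A :: "'a::euclidean_space set" and d :: "'b \<Rightarrow> 'b \<Rightarrow> real"
  assumes tri: "\<And>u v w. d (F u) (F w) \<le> d (F u) (F v) + d (F v) (F w)"
    and small: "\<And>e. 0 < e \<Longrightarrow> \<exists>\<delta>>0. \<forall>u v. norm (u - v) \<le> \<delta> \<longrightarrow> d (F u) (F v) < e"
    and alike: "\<And>e. 0 < e \<Longrightarrow> \<exists>R. \<forall>u v. alike A R u v \<longrightarrow> d (F u) (F v) < e"
    and "0 < e"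
  shows "\<exists>\<delta>>0. \<forall>s t. tiling_dist (translate A s) (translate A t) < \<delta> \<longrightarrow> d (F s) (F t) < e"
proof -
  obtain \<eta> where \<eta>: "0 < \<eta>" "\<And>u v. norm (u - v) \<le> \<eta> \<Longrightarrow> d (F u) (F v) < e / 3"
    using small[of "e / 3"] \<open>0 < e\<close> by auto
  obtain R where R: "\<And>u v. alike A R u v \<Longrightarrow> d (F u) (F v) < e / 3"
    using alike[of "e / 3"] \<open>0 < e\<close> by auto
  define \<delta> where "\<delta> = min (min 1 \<eta>) (1 / (\<bar>R\<bar> + 1))"
  have \<delta>: "0 < \<delta>" "\<delta> \<le> 1" "\<delta> \<le> \<eta>" "\<delta> \<le> 1 / (\<bar>R\<bar> + 1)"
    using \<eta>(1) by (auto simp: \<delta>_def add_nonneg_pos)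
  have "\<bar>R\<bar> + 1 \<le> 1 / \<delta>"
    using \<delta>(1,4) by (simp add: field_simps)
  then have R\<delta>: "R \<le> 1 / \<delta>"
    by linarith
  have "d (F s) (F t) < e" if "tiling_dist (translate A s) (translate A t) < \<delta>" for s t
  proof -
    note st = that
    obtain a b where ab: "norm a + norm b \<le> \<delta>" "alike A (1 / \<delta>) (s + a) (t + b)"
      using tiling_dist_imp_alike[OF st \<delta>(2)] .
    have "norm a \<le> \<delta>" "norm b \<le> \<delta>"
      using ab(1) norm_ge_zero[of a] norm_ge_zero[of b] by linarith+
    then have "norm a \<le> \<eta>" "norm b \<le> \<eta>"
      using \<delta>(3) by linarith+
    then have "d (F s) (F (s + a)) < e / 3" "d (F (t + b)) (F t) < e / 3"
      using \<eta>(2)[of s "s + a"] \<eta>(2)[of "t + b" t] by simp_all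
    moreover have "d (F (s + a)) (F (t + b)) < e / 3"
      using R alike_mono[OF ab(2) R\<delta>] by blast
    ultimately show ?thesis
      using tri[of s t "s + a"] tri[of "s + a" t "t + b"] by linarith
  qed
  then show ?thesis
    using \<delta>(1) by blast
qed

section \<open>Eigenvalues and return vectors\<close>

definition circ :: "real \<Rightarrow> complex"
  where "circ y = exp (2 * of_real pi * \<i> * of_real y)"

lemma circ_add: "circ (x + y) = circ x * circ y"
  by (simp add: circ_def exp_add[symmetric] distrib_left)

lemma circ_eq: "circ y = exp (\<i> * complex_of_real (2 * pi * y))"
  by (simp add: circ_def mult_ac)

lemma norm_circ [simp]: "norm (circ y) = 1"
  unfolding circ_eq by (rule norm_exp_i_times)

lemma circ_of_int [simp]: "circ (of_int n) = 1"
  using exp_integer_2pi[of "of_int n"] by (simp add: circ_def mult_ac)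

lemma circ_nonzero [simp]: "circ y \<noteq> 0"
  by (simp add: circ_def)

lemma circ_diff: "circ (x - y) = circ x / circ y"
  using circ_add[of "x - y" y] by simp

lemma norm_circ_diff: "norm (circ x - circ y) = norm (circ (x - y) - 1)"
proof -
  have "circ x - circ y = circ y * (circ (x - y) - 1)"
    using circ_add[of y "x - y"] by (simp add: algebra_simps)
  then show ?thesis
    by (simp add: norm_mult)
qed

lemma norm_circ_minus_1: "norm (circ y - 1) = 2 * \<bar>sin (pi * y)\<bar>"
  unfolding circ_eq dist_exp_i_1 by (simp add: mult_ac)

lemma norm_circ_minus_1_le: "norm (circ y - 1) \<le> 2 * pi * \<bar>y - of_int n\<bar>"
proof -
  have "norm (circ y - 1) = norm (circ (y - of_int n) - 1)"
    by (simp add: circ_diff)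
  also have "\<dots> = 2 * \<bar>sin (pi * (y - of_int n))\<bar>"
    by (rule norm_circ_minus_1)
  also have "\<dots> \<le> 2 * \<bar>pi * (y - of_int n)\<bar>"
    using abs_sin_x_le_abs_x by auto
  finally show ?thesis
    by (simp add: abs_mult)
qed

text \<open>The chord length \<open>2 * sin (pi * \<bar>f\<bar>)\<close> increases with the distance
  \<open>\<bar>f\<bar> \<le> 1 / 2\<close> to the nearest integer, so a short chord forces a short
  distance.\<close>

lemma circ_near_1_imp_near_int:
  assumes "0 < \<eta>" "\<eta> \<le> 1 / 2" "norm (circ y - 1) < 2 * sin (pi * \<eta>)"
  shows "\<exists>n::int. \<bar>y - of_int n\<bar> < \<eta>"
proof (intro exI)
  define f where "f = y - of_int (round y)"
  have f: "\<bar>f\<bar> \<le> 1 / 2"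
    unfolding f_def using of_int_round_abs_le[of y] by (simp add: abs_minus_commute)
  have "norm (circ y - 1) = norm (circ f - 1)"
    by (simp add: circ_diff f_def)
  also have "\<dots> = 2 * \<bar>sin (pi * f)\<bar>"
    by (rule norm_circ_minus_1)
  also have "\<bar>sin (pi * f)\<bar> = sin (pi * \<bar>f\<bar>)"
  proof -
    have "0 \<le> sin (pi * \<bar>f\<bar>)"
    proof (rule sin_ge_zero)
      have "pi * \<bar>f\<bar> \<le> pi * 1"
        using f by (intro mult_left_mono) auto
      then show "pi * \<bar>f\<bar> \<le> pi" by simp
    qed simp
    then show ?thesis
      by (cases "f \<ge> 0") auto
  qed
  finally have lt: "sin (pi * \<bar>f\<bar>) < sin (pi * \<eta>)"
    using assms(3) by simp
  show "\<bar>y - of_int (round y)\<bar> < \<eta>"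
  proof (rule ccontr)
    assume "\<not> ?thesis"
    then have "\<eta> \<le> \<bar>f\<bar>"
      by (simp add: f_def)
    moreover have "- (pi / 2) \<le> pi * \<eta>"
      using assms(1) by (meson less_imp_le mult_nonneg_nonneg neg_le_0_iff_le order_trans pi_ge_zero pi_half_ge_zero)
    moreover have "pi * \<bar>f\<bar> \<le> pi / 2"
      using mult_left_mono[OF f, of pi] by simp
    ultimately have "sin (pi * \<eta>) \<le> sin (pi * \<bar>f\<bar>)"
      by (intro sin_monotone_2pi_le mult_left_mono) auto
    with lt show False by simp
  qed
qed

lemma circ_near_1_imp_near_int':
  assumes "0 < \<eta>"
  obtains e where "0 < e" "\<And>y. norm (circ y - 1) < e \<Longrightarrow> \<exists>n::int. \<bar>y - of_int n\<bar> < \<eta>"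
proof -
  define m where "m = min \<eta> (1 / 2)"
  have m: "0 < m" "m \<le> 1 / 2" "m \<le> \<eta>"
    using assms by (auto simp: m_def)
  have "pi * m \<le> pi * (1 / 2)"
    using m(2) by (intro mult_left_mono) auto
  then have "pi * m < pi"
    using pi_gt_zero by linarith
  then have "0 < 2 * sin (pi * m)"
    using m(1) by (simp add: sin_gt_zero)
  moreover have "\<exists>n::int. \<bar>y - of_int n\<bar> < \<eta>" if "norm (circ y - 1) < 2 * sin (pi * m)" for y
    using circ_near_1_imp_near_int[OF m(1,2) that] m(3) by (meson less_le_trans)
  ultimately show thesis
    using that by blast
qed

section \<open>Recurrence and near-integrality on return vectors\<close>

text \<open>The working form of repetitivity: centres range over the whole space, which is the form
  that can be carried through a conjugacy.\<close>

definition recurrent :: "'a::euclidean_space set \<Rightarrow> bool"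
  where "recurrent A \<longleftrightarrow> (\<forall>R u. \<exists>K. \<forall>v. \<exists>t. norm (v - t) \<le> K \<and> alike A R u t)"

lemma patch_eq_imp_alike:
  assumes "patch A R (x + t) = (\<lambda>y. y + t) ` patch A R x"
  shows "alike A R x (x + t)"
  unfolding alike_def
proof (intro allI impI)
  fix z :: 'a assume z: "norm z \<le> R"
  have "z + (x + t) \<in> A \<longleftrightarrow> z + (x + t) \<in> patch A R (x + t)"
    using z by (simp add: patch_def dist_norm norm_minus_commute)
  also have "\<dots> \<longleftrightarrow> z + x \<in> patch A R x"
    unfolding assms by (auto simp: image_iff algebra_simps)
  also have "\<dots> \<longleftrightarrow> z + x \<in> A"
    using z by (simp add: patch_def dist_norm norm_minus_commute)
  finally show "z + x \<in> A \<longleftrightarrow> z + (x + t) \<in> A" by simp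
qed

text \<open>A patch about an arbitrary \<open>u\<close> sits inside a larger patch about some point
  of \<open>A\<close> and recurs along with it.\<close>

lemma repetitive_imp_recurrent:
  assumes "repetitive A" "A \<noteq> {}"
  shows "recurrent A"
  unfolding recurrent_def
proof (intro allI)
  fix R :: real and u :: 'a
  obtain x where x: "x \<in> A"
    using assms(2) by blast
  define r where "r = \<bar>R\<bar> + norm (u - x) + 1"
  have "0 < r"
    by (simp add: r_def add_nonneg_pos)
  obtain K where K: "\<And>v. \<exists>t. patch A r (x + t) = (\<lambda>y. y + t) ` patch A r x \<and> dist v t \<le> K"
  proof -
    have "relatively_dense {t. patch A r (x + t) = (\<lambda>y. y + t) ` patch A r x}"
      using assms(1) x \<open>0 < r\<close> unfolding repetitive_def by blast
    with that show thesis
      unfolding relatively_dense_def by auto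
  qed
  have "\<exists>t. norm (v - t) \<le> K \<and> alike A R u t" for v
  proof -
    obtain t where t: "patch A r (x + t) = (\<lambda>y. y + t) ` patch A r x" "dist (v - u) t \<le> K"
      using K by blast
    have "alike A R (x + (u - x)) (x + t + (u - x))"
      using patch_eq_imp_alike[OF t(1)] by (rule alike_shift) (simp add: r_def)
    then show ?thesis
      using t(2) by (intro exI[of _ "u + t"]) (simp add: dist_norm algebra_simps)
  qed
  then show "\<exists>K. \<forall>v. \<exists>t. norm (v - t) \<le> K \<and> alike A R u t"
    by blast
qed

text \<open>For linear \<open>\<beta>\<close> this says that the patch at \<open>t\<close> nearly
  determines \<open>circ (\<beta> t)\<close>. The argument is a plain function so that inner
  products and coordinates of a linear map fit too.\<close>

definition returns_near_int :: "'a::euclidean_space set \<Rightarrow> ('a \<Rightarrow> real) \<Rightarrow> bool"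
  where "returns_near_int A \<beta> \<longleftrightarrow>
    (\<forall>\<eta>>0. \<exists>R. \<forall>u v. alike A R u v \<longrightarrow> (\<exists>n::int. \<bar>\<beta> (v - u) - of_int n\<bar> < \<eta>))"

lemma continuous_map_complex_mult:
  fixes f g :: "'b \<Rightarrow> complex"
  shows "continuous_map X euclidean f \<Longrightarrow> continuous_map X euclidean g \<Longrightarrow> continuous_map X euclidean (\<lambda>x. f x * g x)"
  by (simp add: continuous_map_atin tendsto_mult)

text \<open>\<open>t \<mapsto> circ (\<beta> t)\<close> is Lipschitz, which handles small shifts,
  and the hypothesis handles equal patches. Its extension satisfies the eigenvalue equation because
  both sides agree on the dense orbit.\<close>

lemma eigenvalue_if_returns_near_int:
  fixes \<beta> :: "'a::euclidean_space \<Rightarrow>\<^sub>L real"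
  assumes "closed A" "returns_near_int A \<beta>"
  shows "topological_eigenvalue A \<beta>"
proof -
  define F where "F t = circ (\<beta> t)" for t
  have FF: "norm (F s - F t) = norm (circ (\<beta> (s - t)) - 1)" for s t
    unfolding F_def norm_circ_diff by (simp add: blinfun.diff_right)
  have unif: "\<exists>\<delta>>0. \<forall>s t. tiling_dist (translate A s) (translate A t) < \<delta> \<longrightarrow> dist (F s) (F t) < e" if "0 < e" for e
    using that
  proof (rule uniform_on_orbit[of dist F, rotated 3])
    show "dist (F u) (F w) \<le> dist (F u) (F v) + dist (F v) (F w)" for u v w
      by (rule dist_triangle)
    show "\<exists>\<delta>>0. \<forall>u v. norm (u - v) \<le> \<delta> \<longrightarrow> dist (F u) (F v) < e" if "0 < e" for e
    proof -
      \<comment> \<open>A Lipschitz constant for \<open>F\<close>; the \<open>+ 1\<close> keeps it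
        positive when \<open>\<beta>\<close> is zero.\<close>
      define c where "c = 2 * pi * (norm \<beta> + 1)"
      have c: "0 < c"
        unfolding c_def by (simp add: add_nonneg_pos)
      have "dist (F u) (F v) < e" if "norm (u - v) \<le> e / c / 2" for u v
      proof -
        have "dist (F u) (F v) \<le> 2 * pi * \<bar>\<beta> (u - v)\<bar>"
          unfolding dist_norm FF using norm_circ_minus_1_le[of "\<beta> (u - v)" 0] by simp
        also have "\<dots> \<le> 2 * pi * ((norm \<beta> + 1) * norm (u - v))"
          using norm_blinfun[of \<beta> "u - v"] by (intro mult_left_mono) (auto simp: distrib_right intro: add_increasing2)
        also have "\<dots> = c * norm (u - v)"
          by (simp add: c_def)
        also have "\<dots> \<le> c * (e / c / 2)"
          using c by (intro mult_left_mono[OF that]) simp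
        also have "\<dots> = e / 2"
          using c by simp
        finally show ?thesis
          using \<open>0 < e\<close> by simp
      qed
      moreover have "0 < e / c / 2"
        using c that by simp
      ultimately show ?thesis by blast
    qed
    show "\<exists>R. \<forall>u v. alike A R u v \<longrightarrow> dist (F u) (F v) < e" if "0 < e" for e
    proof -
      obtain R where R: "\<And>u v. alike A R u v \<Longrightarrow> \<exists>n::int. \<bar>\<beta> (v - u) - of_int n\<bar> < e / (2 * pi)"
        using assms(2) \<open>0 < e\<close> unfolding returns_near_int_def by (meson divide_pos_pos mult_pos_pos pi_gt_zero zero_less_numeral)
      have "dist (F u) (F v) < e" if uv: "alike A R u v" for u v
      proof -
        obtain n :: int where n: "\<bar>\<beta> (v - u) - of_int n\<bar> < e / (2 * pi)"
          using R[OF uv] by blast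
        have "dist (F u) (F v) = norm (circ (\<beta> (v - u)) - 1)"
          unfolding dist_commute[of "F u"] unfolding dist_norm FF ..
        also have "\<dots> \<le> 2 * pi * \<bar>\<beta> (v - u) - of_int n\<bar>"
          by (rule norm_circ_minus_1_le)
        also have "\<dots> < e"
          using n by (simp add: field_simps)
        finally show ?thesis .
      qed
      then show ?thesis by blast
    qed
  qed
  have "mcomplete_of (euclidean_metric :: complex metric)"
    by (simp add: mcomplete_of_def complete_UNIV)
  then obtain f where f: "continuous_map (hull_topology A) euclidean f" "\<And>t. f (translate A t) = F t"
    using extend_from_orbit[of A euclidean_metric F] assms(1) unif by auto
  have "f (translate \<omega> t) = circ (\<beta> t) * f \<omega>" if "\<omega> \<in> hull_of A" for t \<omega>
  proof (rule forall_in_closure_of_eq[of \<omega> "hull_topology A" "range (translate A)" euclidean])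
    show "continuous_map (hull_topology A) euclidean (\<lambda>\<omega>. f (translate \<omega> t))"
      using continuous_map_compose[OF continuous_map_translate[OF assms(1), of t] f(1)] by (simp add: o_def)
    show "continuous_map (hull_topology A) euclidean (\<lambda>\<omega>. circ (\<beta> t) * f \<omega>)"
      using f(1) by (intro continuous_map_complex_mult) simp
    show "f (translate \<omega> t) = circ (\<beta> t) * f \<omega>" if \<omega>: "\<omega> \<in> range (translate A)" for \<omega>
    proof -
      obtain s where "\<omega> = translate A s"
        using \<omega> by blast
      then show ?thesis
        by (simp add: f(2) F_def blinfun.add_right circ_add[symmetric] add.commute)
    qed
  qed (use that orbit_dense[OF assms(1)] in auto)
  moreover have "f (translate A 0) \<noteq> 0"
    unfolding f(2) F_def by simp
  ultimately show ?thesis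
    unfolding topological_eigenvalue_def circ_def[symmetric] using f(1) translate_in_hull[OF assms(1)] by blast
qed

text \<open>Continuity at the single point \<open>A\<close> controls returns of the patch about
  \<open>0\<close> only. For arbitrary \<open>u\<close>, \<open>v\<close>, recurrence puts a copy of
  that patch at some \<open>t\<close> near \<open>u\<close>, and equal patches carry it to
  \<open>v + (t - u)\<close>; then \<open>\<beta> (v - u)\<close> is a difference of two controlled
  values.\<close>

lemma returns_near_int_if_eigenvalue:
  fixes \<beta> :: "'a::euclidean_space \<Rightarrow>\<^sub>L real"
  assumes "closed A" "recurrent A" "topological_eigenvalue A \<beta>"
  shows "returns_near_int A \<beta>"
  unfolding returns_near_int_def
proof (intro allI impI)
  fix \<eta> :: real assume "0 < \<eta>"
  obtain f where f: "continuous_map (hull_topology A) euclidean f" "\<exists>\<omega>\<in>hull_of A. f \<omega> \<noteq> 0"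
    "\<And>t \<omega>. \<omega> \<in> hull_of A \<Longrightarrow> f (translate \<omega> t) = circ (\<beta> t) * f \<omega>"
    using assms(3) unfolding topological_eigenvalue_def circ_def[symmetric] by blast
  have A: "A \<in> hull_of A"
    using translate_in_hull[OF assms(1), of 0] by simp
  have ft: "f (translate A t) = circ (\<beta> t) * f A" for t
    using f(3)[OF A] .
  have "f A \<noteq> 0"
  proof
    assume "f A = 0"
    have "f \<omega> = 0" if "\<omega> \<in> hull_of A" for \<omega>
      by (rule forall_in_closure_of_eq[of \<omega> "hull_topology A" "range (translate A)" euclidean f "\<lambda>_. 0"])
        (use that orbit_dense[OF assms(1)] f(1) \<open>f A = 0\<close> ft in auto)
    with f(2) show False by blast
  qed
  obtain e where e: "0 < e" "\<And>y. norm (circ y - 1) < e \<Longrightarrow> \<exists>n::int. \<bar>y - of_int n\<bar> < \<eta> / 2"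
    using circ_near_1_imp_near_int'[of "\<eta> / 2"] \<open>0 < \<eta>\<close> by auto
  have "\<exists>\<delta>>0. \<forall>\<omega>\<in>hull_of A. tiling_dist A \<omega> < \<delta> \<longrightarrow> dist (f A) (f \<omega>) < e * norm (f A)"
  proof -
    interpret H: Submetric "Collect closed :: 'a set set" tiling_dist "hull_of A"
      by unfold_locales (rule hull_subset_closed)
    have "continuous_map H.sub.mtopology Met_TC.mtopology f"
      using f(1) unfolding hull_topology_def H.mtopology_submetric by simp
    then show ?thesis
      unfolding H.sub.metric_continuous_map[OF Met_TC.Metric_space_axioms]
      using A \<open>0 < e\<close> \<open>f A \<noteq> 0\<close> by (simp add: Ball_def imp_conjL)
  qed
  then obtain \<delta> where \<delta>: "0 < \<delta>" "\<And>\<omega>. \<omega> \<in> hull_of A \<Longrightarrow> tiling_dist A \<omega> < \<delta> \<Longrightarrow> dist (f A) (f \<omega>) < e * norm (f A)"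
    by blast
  define R where "R = 2 / \<delta>"
  have near: "\<exists>n::int. \<bar>\<beta> t - of_int n\<bar> < \<eta> / 2" if "alike A R 0 t" for t
  proof (rule e(2))
    have "tiling_dist A (translate A t) \<le> 1 / R"
      using alike_imp_tiling_dist[OF that] \<delta>(1) by (simp add: R_def)
    also have "\<dots> < \<delta>"
      using \<delta>(1) by (simp add: R_def)
    finally have "norm (f A - circ (\<beta> t) * f A) < e * norm (f A)"
      using \<delta>(2)[OF translate_in_hull[OF assms(1)], of t] by (simp add: ft dist_norm)
    moreover have "f A - circ (\<beta> t) * f A = (1 - circ (\<beta> t)) * f A"
      by (simp add: algebra_simps)
    ultimately show "norm (circ (\<beta> t) - 1) < e"
      using \<open>f A \<noteq> 0\<close> by (simp add: norm_mult norm_minus_commute)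
  qed
  obtain K where K: "\<And>v. \<exists>t. norm (v - t) \<le> K \<and> alike A R 0 t"
    using assms(2) unfolding recurrent_def by meson
  have "\<exists>n::int. \<bar>\<beta> (v - u) - of_int n\<bar> < \<eta>" if uv: "alike A (R + K) u v" for u v
  proof -
    obtain t where t: "norm (u - t) \<le> K" "alike A R 0 t"
      using K by blast
    have "alike A R (u + (t - u)) (v + (t - u))"
      using uv by (rule alike_shift) (use t(1) in \<open>simp add: norm_minus_commute\<close>)
    then have "alike A R 0 (v + (t - u))"
      using t(2) alike_trans by auto
    then obtain m n :: int where "\<bar>\<beta> t - of_int m\<bar> < \<eta> / 2" "\<bar>\<beta> (v + (t - u)) - of_int n\<bar> < \<eta> / 2"
      using near t(2) by blast
    then have "\<bar>\<beta> (v - u) - of_int (n - m)\<bar> < \<eta>"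
      by (simp add: blinfun.add_right blinfun.diff_right) argo
    then show ?thesis ..
  qed
  then show "\<exists>R. \<forall>u v. alike A R u v \<longrightarrow> (\<exists>n::int. \<bar>\<beta> (v - u) - of_int n\<bar> < \<eta>)"
    by blast
qed

section \<open>Conjugacies from agreement of patches\<close>

lemma conjugate_half:
  fixes A B :: "'a::euclidean_space set"
  assumes "closed A" "closed B"
    and crit: "\<And>e. 0 < e \<Longrightarrow> \<exists>R. \<forall>u v. alike A R u v \<longrightarrow> tiling_dist (translate B u) (translate B v) < e"
  obtains h where "continuous_map (hull_topology A) (hull_topology B) h" "\<And>t. h (translate A t) = translate B t"
proof -
  let ?m = "metric (Collect closed :: 'a set set, tiling_dist)"
  have unif: "\<exists>\<delta>>0. \<forall>s t. tiling_dist (translate A s) (translate A t) < \<delta> \<longrightarrow>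
      tiling_dist (translate B s) (translate B t) < e" if "0 < e" for e
    using that
  proof (rule uniform_on_orbit[of tiling_dist "translate B", rotated 3])
    show "\<exists>\<delta>>0. \<forall>u v. norm (u - v) \<le> \<delta> \<longrightarrow> tiling_dist (translate B u) (translate B v) < e" if "0 < e" for e
    proof (intro exI[of _ "e / 2"] conjI allI impI)
      fix u v :: 'a assume "norm (u - v) \<le> e / 2"
      then show "tiling_dist (translate B u) (translate B v) < e"
        using tiling_dist_translate_self[of "translate B u" "v - u"] that by (simp add: norm_minus_commute)
    qed (use that in simp)
  qed (use crit tiling_dist_triangle in auto)
  have "mcomplete_of ?m"
    using tiling_mcomplete by (simp add: mcomplete_of_def)
  then obtain h where h: "continuous_map (hull_topology A) tiling.mtopology h" "\<And>t. h (translate A t) = translate B t"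
    using extend_from_orbit[of A ?m "translate B"] assms(1) unif closed_translate[OF assms(2)]
    by auto
  have "h \<omega> \<in> hull_of B" if "\<omega> \<in> hull_of A" for \<omega>
  proof -
    have "h ` (hull_topology A closure_of range (translate A)) \<subseteq> tiling.mtopology closure_of (h ` range (translate A))"
      using h(1) continuous_map_image_closure_subset by blast
    moreover have "h ` range (translate A) = range (translate B)"
      using h(2) by (auto simp: image_iff)
    ultimately show ?thesis
      using that orbit_dense[OF assms(1)] by (auto simp: hull_of_def[of B])
  qed
  then have "continuous_map (hull_topology A) (hull_topology B) h"
    unfolding hull_topology_def[of B] using h(1) by (auto simp: continuous_map_in_subtopology)
  with h(2) show thesis
    using that by blast
qed

lemma Hausdorff_space_hull: "Hausdorff_space (hull_topology A)"
  unfolding hull_topology_def by (simp add: Hausdorff_space_subtopology tiling.Hausdorff_space_mtopology)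

text \<open>The conjugacy obtained sends \<open>A\<close> to \<open>B\<close>. Both extensions are
  equivariant and mutually inverse on the orbits, hence on the hulls, by density and the Hausdorff
  property.\<close>

lemma conjugate_if_alike:
  fixes A B :: "'a::euclidean_space set"
  assumes cl: "closed A" "closed B"
    and AB: "\<And>e. 0 < e \<Longrightarrow> \<exists>R. \<forall>u v. alike A R u v \<longrightarrow> tiling_dist (translate B u) (translate B v) < e"
    and BA: "\<And>e. 0 < e \<Longrightarrow> \<exists>R. \<forall>u v. alike B R u v \<longrightarrow> tiling_dist (translate A u) (translate A v) < e"
  shows "topologically_conjugate A B"
proof -
  obtain h where h: "continuous_map (hull_topology A) (hull_topology B) h" "\<And>t. h (translate A t) = translate B t"
    using conjugate_half[OF cl AB] by blast
  obtain k where k: "continuous_map (hull_topology B) (hull_topology A) k" "\<And>t. k (translate B t) = translate A t"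
    using conjugate_half[OF cl(2,1) BA] by blast
  have hd: "h (translate \<omega> t) = translate (h \<omega>) t" if "\<omega> \<in> hull_of A" for \<omega> t
  proof (rule forall_in_closure_of_eq[of \<omega> "hull_topology A" "range (translate A)" "hull_topology B"])
    show "continuous_map (hull_topology A) (hull_topology B) (\<lambda>\<omega>. h (translate \<omega> t))"
      using continuous_map_compose[OF continuous_map_translate[OF cl(1), of t] h(1)] by (simp add: o_def)
    show "continuous_map (hull_topology A) (hull_topology B) (\<lambda>\<omega>. translate (h \<omega>) t)"
      using continuous_map_compose[OF h(1) continuous_map_translate[OF cl(2), of t]] by (simp add: o_def)
  qed (use that orbit_dense[OF cl(1)] Hausdorff_space_hull h(2) in auto)
  have kh: "k (h \<omega>) = \<omega>" if "\<omega> \<in> hull_of A" for \<omega>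
    by (rule forall_in_closure_of_eq[of \<omega> "hull_topology A" "range (translate A)" "hull_topology A"])
      (use that orbit_dense[OF cl(1)] Hausdorff_space_hull h(2) k(2)
        continuous_map_compose[OF h(1) k(1)] in \<open>auto simp: o_def\<close>)
  have hk: "h (k \<omega>) = \<omega>" if "\<omega> \<in> hull_of B" for \<omega>
    by (rule forall_in_closure_of_eq[of \<omega> "hull_topology B" "range (translate B)" "hull_topology B"])
      (use that orbit_dense[OF cl(2)] Hausdorff_space_hull h(2) k(2)
        continuous_map_compose[OF k(1) h(1)] in \<open>auto simp: o_def\<close>)
  have "homeomorphic_maps (hull_topology A) (hull_topology B) h k"
    unfolding homeomorphic_maps_def using h(1) k(1) kh hk by simp
  then have "homeomorphic_map (hull_topology A) (hull_topology B) h"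
    using homeomorphic_maps_map by blast
  with hd show ?thesis
    unfolding topologically_conjugate_def by blast
qed

section \<open>Harmonious sets\<close>

text \<open>Total boundedness for the pseudometric of finitely many bounded functions, with net
  points in \<open>S\<close> itself. The induction cuts \<open>S\<close> according to the small ball
  that contains \<open>f j s\<close>.\<close>

lemma finite_net_of_bounded_functions:
  fixes f :: "'i \<Rightarrow> 's \<Rightarrow> complex"
  assumes "finite J" "0 < \<delta>" "\<And>i s. norm (f i s) \<le> 1"
  shows "\<exists>T. finite T \<and> T \<subseteq> S \<and> (\<forall>s\<in>S. \<exists>t\<in>T. \<forall>i\<in>J. norm (f i s - f i t) < \<delta>)"
  using assms(1)
proof (induction J arbitrary: S)
  case empty
  show ?case
  proof (cases "S = {}")
    case False
    then obtain s where "s \<in> S" by blast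
    then show ?thesis by (intro exI[of _ "{s}"]) auto
  qed auto
next
  case (insert j J)
  obtain C where C: "finite C" "cball 0 1 \<subseteq> (\<Union>c\<in>C. ball c (\<delta> / 2) :: complex set)"
    using compact_cball[of "0::complex" 1] \<open>0 < \<delta>\<close> unfolding compact_eq_totally_bounded
    by (meson half_gt_zero)
  define P where "P c = {s \<in> S. f j s \<in> ball c (\<delta> / 2)}" for c
  have "\<forall>c. \<exists>T. finite T \<and> T \<subseteq> P c \<and> (\<forall>s\<in>P c. \<exists>t\<in>T. \<forall>i\<in>J. norm (f i s - f i t) < \<delta>)"
    using insert.IH by blast
  from choice[OF this] obtain T where T: "\<And>c. finite (T c)" "\<And>c. T c \<subseteq> P c"
    "\<And>c s. s \<in> P c \<Longrightarrow> \<exists>t\<in>T c. \<forall>i\<in>J. norm (f i s - f i t) < \<delta>"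
    by blast
  show ?case
  proof (intro exI[of _ "\<Union>c\<in>C. T c"] conjI ballI)
    show "finite (\<Union>c\<in>C. T c)"
      using C(1) T(1) by blast
    show "(\<Union>c\<in>C. T c) \<subseteq> S"
      using T(2) by (auto simp: P_def)
    fix s assume s: "s \<in> S"
    have "f j s \<in> cball 0 1"
      using assms(3) by simp
    then obtain c where c: "c \<in> C" "s \<in> P c"
      using C(2) s unfolding P_def by blast
    then obtain t where t: "t \<in> T c" "\<forall>i\<in>J. norm (f i s - f i t) < \<delta>"
      using T(3) by blast
    have "dist c (f j s) < \<delta> / 2" "dist c (f j t) < \<delta> / 2"
      using c(2) T(2)[of c] t(1) by (auto simp: P_def)
    then have "dist (f j s) (f j t) < \<delta>"
      by (rule dist_triangle_half_r)
    then show "\<exists>t\<in>\<Union>c\<in>C. T c. \<forall>i\<in>insert j J. norm (f i s - f i t) < \<delta>"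
      using t c(1) by (auto simp: dist_norm)
  qed
qed

text \<open>The Riesz representative of \<open>\<beta>\<close>.\<close>

definition vec_of :: "('a::euclidean_space \<Rightarrow>\<^sub>L real) \<Rightarrow> 'a"
  where "vec_of \<beta> = (\<Sum>i\<in>Basis. \<beta> i *\<^sub>R i)"

lemma blinfun_apply_eq_inner: "blinfun_apply \<beta> x = vec_of \<beta> \<bullet> x"
proof -
  have "\<beta> x = \<beta> (\<Sum>i\<in>Basis. (x \<bullet> i) *\<^sub>R i)"
    by (simp add: euclidean_representation)
  also have "\<dots> = (\<Sum>i\<in>Basis. (x \<bullet> i) * \<beta> i)"
    by (simp add: blinfun.sum_right blinfun.scaleR_right)
  also have "\<dots> = vec_of \<beta> \<bullet> x"
    by (simp add: vec_of_def inner_sum_left inner_commute[of x] mult.commute)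
  finally show ?thesis .
qed

lemma linear_vec_of: "linear vec_of"
  by (rule linearI) (simp_all add: vec_of_def blinfun.add_left blinfun.scaleR_left scaleR_add_left
      sum.distrib scaleR_sum_right)

lemma inj_vec_of: "inj vec_of"
  by (rule injI) (metis blinfun_apply_eq_inner blinfun_eqI)

section \<open>The compact dual of the generated group\<close>

text \<open>The Pontryagin dual of the discrete group generated by \<open>A\<close>: circle-valued
  homomorphisms with pointwise convergence, as a closed subspace of a product of circles and so
  compact by Tychonoff.\<close>

definition dual_group_top :: "'a::euclidean_space set \<Rightarrow> ('a \<Rightarrow> complex) topology"
  where "dual_group_top A = subtopology (product_topology (\<lambda>_. top_of_set (sphere 0 1)) (group_closure A))
    {\<phi>. \<forall>a\<in>group_closure A. \<forall>b\<in>group_closure A. \<phi> (a + b) = \<phi> a * \<phi> b}"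

lemma topspace_dual_group:
  "\<phi> \<in> topspace (dual_group_top A) \<longleftrightarrow> \<phi> \<in> extensional (group_closure A) \<and>
    (\<forall>a\<in>group_closure A. \<phi> a \<in> sphere 0 1) \<and>
    (\<forall>a\<in>group_closure A. \<forall>b\<in>group_closure A. \<phi> (a + b) = \<phi> a * \<phi> b)"
  unfolding dual_group_top_def by (auto simp: PiE_iff)

lemma continuous_map_eval:
  assumes "a \<in> group_closure A"
  shows "continuous_map (product_topology (\<lambda>_. top_of_set (sphere 0 1)) (group_closure A)) euclidean (\<lambda>\<phi>. \<phi> a :: complex)"
  using continuous_map_product_projection[OF assms, of "\<lambda>_. top_of_set (sphere 0 (1::real) :: complex set)"]
  by (rule continuous_map_into_fulltopology)

lemma compact_dual_group: "compact_space (dual_group_top A)"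
proof -
  let ?X = "product_topology (\<lambda>_. top_of_set (sphere 0 1)) (group_closure A) :: ('a \<Rightarrow> complex) topology"
  have X: "compact_space ?X"
    by (simp add: compact_space_product_topology compact_space_subtopology)
  have "closedin ?X {\<phi> \<in> topspace ?X. \<phi> (a + b) = \<phi> a * \<phi> b}"
    if "a \<in> group_closure A" "b \<in> group_closure A" for a b
    using that by (intro closedin_continuous_maps_eq[of euclidean] continuous_map_eval group_closure_add
        continuous_map_complex_mult) auto
  then have "closedin ?X (\<Inter>p\<in>group_closure A \<times> group_closure A. {\<phi> \<in> topspace ?X. \<phi> (fst p + snd p) = \<phi> (fst p) * \<phi> (snd p)})"
    by (intro closedin_Inter) (auto intro: zero_in_group_closure)
  also have "(\<Inter>p\<in>group_closure A \<times> group_closure A. {\<phi> \<in> topspace ?X. \<phi> (fst p + snd p) = \<phi> (fst p) * \<phi> (snd p)}) =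
     topspace ?X \<inter> {\<phi>. \<forall>a\<in>group_closure A. \<forall>b\<in>group_closure A. \<phi> (a + b) = \<phi> a * \<phi> b}"
    using zero_in_group_closure[of A] by (fastforce simp del: topspace_product_topology)
  finally have "compactin ?X (topspace ?X \<inter> {\<phi>. \<forall>a\<in>group_closure A. \<forall>b\<in>group_closure A. \<phi> (a + b) = \<phi> a * \<phi> b})"
    by (rule closedin_compact_space[OF X])
  then have "compact_space (subtopology ?X (topspace ?X \<inter> {\<phi>. \<forall>a\<in>group_closure A. \<forall>b\<in>group_closure A. \<phi> (a + b) = \<phi> a * \<phi> b}))"
    by (rule compact_space_subtopology)
  then show ?thesis
    unfolding dual_group_top_def by (simp only: subtopology_restrict)
qed

lemma Hausdorff_dual_group: "Hausdorff_space (dual_group_top A)"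
  unfolding dual_group_top_def
  by (intro Hausdorff_space_subtopology) (simp add: Hausdorff_space_product_topology Hausdorff_space_subtopology)

lemma continuous_map_dual_eval:
  assumes "a \<in> group_closure A"
  shows "continuous_map (dual_group_top A) euclidean (\<lambda>\<phi>. \<phi> a)"
  unfolding dual_group_top_def by (intro continuous_map_from_subtopology continuous_map_eval assms)

text \<open>The set is the projection of a closed set of pairs \<open>(\<phi>, b)\<close> with
  \<open>b\<close> in a compact ball, and projecting away a compact factor is a closed map.\<close>

lemma closedin_near_exponentials:
  "closedin (dual_group_top A) {\<phi> \<in> topspace (dual_group_top A).
     \<exists>b. norm b \<le> r \<and> (\<forall>a\<in>A. norm (\<phi> a - circ (b \<bullet> a)) \<le> \<epsilon>)}"
proof -
  let ?B = "top_of_set (cball 0 r) :: 'a topology"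
  let ?P = "prod_topology (dual_group_top A) ?B"
  have one: "closedin ?P {z \<in> topspace ?P. norm (fst z a - circ (snd z \<bullet> a)) \<in> {..\<epsilon>}}" if "a \<in> A" for a
  proof (rule closedin_continuous_map_preimage)
    have "a \<in> group_closure A"
      using that by (simp add: group_closure.base)
    then have 1: "continuous_map ?P euclidean (\<lambda>z. fst z a)"
      using continuous_map_compose[OF continuous_map_fst continuous_map_dual_eval, of a A ?B] by (simp add: o_def)
    have "continuous_map euclidean euclidean (\<lambda>b::'a. circ (b \<bullet> a))"
      unfolding circ_def by (auto intro!: continuous_intros)
    then have "continuous_map ?B euclidean (\<lambda>b::'a. circ (b \<bullet> a))"
      by (rule continuous_map_from_subtopology)
    then have 2: "continuous_map ?P euclidean (\<lambda>z. circ (snd z \<bullet> a))"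
      using continuous_map_compose[OF continuous_map_snd, of ?B euclidean "\<lambda>b. circ (b \<bullet> a)" "dual_group_top A"]
      by (simp add: o_def)
    show "continuous_map ?P euclideanreal (\<lambda>z. norm (fst z a - circ (snd z \<bullet> a)))"
      using 1 2 by (intro continuous_map_norm continuous_map_diff)
  qed auto
  have "closedin ?P (topspace ?P \<inter> (\<Inter>a\<in>A. {z \<in> topspace ?P. norm (fst z a - circ (snd z \<bullet> a)) \<in> {..\<epsilon>}}))"
  proof (cases "A = {}")
    case False
    then show ?thesis
      using one by (intro closedin_Int closedin_topspace closedin_Inter) auto
  next
    case True
    then have "(\<Inter>a\<in>A. {z \<in> topspace ?P. norm (fst z a - circ (snd z \<bullet> a)) \<in> {..\<epsilon>}}) = UNIV"
      by simp
    then show ?thesis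
      using closedin_topspace[of ?P] by (simp only: Int_UNIV_right)
  qed
  moreover have "compact_space ?B"
    by (simp add: compact_space_subtopology)
  ultimately have "closedin (dual_group_top A)
    (fst ` (topspace ?P \<inter> (\<Inter>a\<in>A. {z \<in> topspace ?P. norm (fst z a - circ (snd z \<bullet> a)) \<in> {..\<epsilon>}})))"
    using closed_map_fst unfolding closed_map_def by blast
  also have "fst ` (topspace ?P \<inter> (\<Inter>a\<in>A. {z \<in> topspace ?P. norm (fst z a - circ (snd z \<bullet> a)) \<in> {..\<epsilon>}}))
    = {\<phi> \<in> topspace (dual_group_top A). \<exists>b. norm b \<le> r \<and> (\<forall>a\<in>A. norm (\<phi> a - circ (b \<bullet> a)) \<le> \<epsilon>)}"
    (is "?L = ?R")
  proof (intro equalityI subsetI)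
    fix \<phi> assume "\<phi> \<in> ?R"
    then obtain b where "\<phi> \<in> topspace (dual_group_top A)" "norm b \<le> r" "\<forall>a\<in>A. norm (\<phi> a - circ (b \<bullet> a)) \<le> \<epsilon>"
      by blast
    then show "\<phi> \<in> ?L"
      by (intro image_eqI[of \<phi> fst "(\<phi>, b)"]) auto
  qed auto
  finally show ?thesis .
qed

lemma openin_dual_group_basis:
  assumes "openin (dual_group_top A) W" "\<phi>0 \<in> W"
  obtains J \<delta> where "finite J" "J \<subseteq> group_closure A" "0 < \<delta>"
    "\<And>\<phi>. \<phi> \<in> topspace (dual_group_top A) \<Longrightarrow> (\<And>g. g \<in> J \<Longrightarrow> norm (\<phi> g - \<phi>0 g) < \<delta>) \<Longrightarrow> \<phi> \<in> W"
proof -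
  let ?X = "product_topology (\<lambda>_. top_of_set (sphere 0 1)) (group_closure A) :: ('a \<Rightarrow> complex) topology"
  obtain V where V: "openin ?X V"
    "W = V \<inter> {\<phi>. \<forall>a\<in>group_closure A. \<forall>b\<in>group_closure A. \<phi> (a + b) = \<phi> a * \<phi> b}"
    using assms(1) unfolding dual_group_top_def openin_subtopology by blast
  obtain U where U: "finite {i \<in> group_closure A. U i \<noteq> sphere 0 1}"
    "\<And>i. i \<in> group_closure A \<Longrightarrow> openin (top_of_set (sphere 0 1)) (U i)"
    "\<phi>0 \<in> PiE (group_closure A) U" "PiE (group_closure A) U \<subseteq> V"
    using V(1) assms(2) unfolding V(2) openin_product_topology_alt by fastforce
  define J where "J = {i \<in> group_closure A. U i \<noteq> sphere 0 1}"
  have "\<forall>i\<in>J. \<exists>d>0. \<forall>z\<in>sphere 0 1. dist z (\<phi>0 i) < d \<longrightarrow> z \<in> U i"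
  proof
    fix i assume "i \<in> J"
    then have "openin (top_of_set (sphere 0 1)) (U i)" "\<phi>0 i \<in> U i"
      using U(2,3) by (auto simp: J_def)
    then show "\<exists>d>0. \<forall>z\<in>sphere 0 1. dist z (\<phi>0 i) < d \<longrightarrow> z \<in> U i"
      unfolding openin_euclidean_subtopology_iff by blast
  qed
  then obtain d where d: "\<And>i. i \<in> J \<Longrightarrow> 0 < d i" "\<And>i z. i \<in> J \<Longrightarrow> z \<in> sphere 0 1 \<Longrightarrow> dist z (\<phi>0 i) < d i \<Longrightarrow> z \<in> U i"
    by metis
  define \<delta> where "\<delta> = Min (insert 1 (d ` J))"
  have fin: "finite J"
    using U(1) by (simp add: J_def)
  have \<delta>: "0 < \<delta>" "\<And>i. i \<in> J \<Longrightarrow> \<delta> \<le> d i"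
    unfolding \<delta>_def using fin d(1) by auto
  show thesis
  proof (rule that[OF fin _ \<delta>(1)])
    show "J \<subseteq> group_closure A"
      by (auto simp: J_def)
    fix \<phi> assume \<phi>: "\<phi> \<in> topspace (dual_group_top A)" "\<And>g. g \<in> J \<Longrightarrow> norm (\<phi> g - \<phi>0 g) < \<delta>"
    have "\<phi> i \<in> U i" if "i \<in> group_closure A" for i
    proof (cases "i \<in> J")
      case True
      then have "dist (\<phi> i) (\<phi>0 i) < d i"
        using \<phi>(2)[OF True] \<delta>(2)[OF True] by (simp add: dist_norm)
      moreover have "\<phi> i \<in> sphere 0 1"
        using \<phi>(1) that unfolding topspace_dual_group by blast
      ultimately show ?thesis
        using d(2) True by blast
    next
      case False
      then show ?thesis
        using that \<phi>(1) unfolding topspace_dual_group J_def by auto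
    qed
    then have "\<phi> \<in> PiE (group_closure A) U"
      using \<phi>(1) unfolding topspace_dual_group by (auto simp: PiE_iff)
    then show "\<phi> \<in> W"
      using U(4) \<phi>(1) unfolding V(2) topspace_dual_group by blast
  qed
qed

text \<open>The closed sets \<open>F n\<close> of characters approximated by vectors of norm at most
  \<open>n\<close> cover the dual, by harmonicity. Baire in a compact Hausdorff space gives one of
  them an interior, hence one norm bound for an open set of characters.\<close>

lemma harmonious_uniformly_near:
  fixes A :: "'a::euclidean_space set"
  assumes "harmonious A" "0 < \<epsilon>"
  obtains n :: nat and W where "openin (dual_group_top A) W" "W \<noteq> {}"
    "\<And>\<phi>. \<phi> \<in> W \<Longrightarrow> \<exists>b. norm b \<le> n \<and> (\<forall>a\<in>A. norm (\<phi> a - circ (b \<bullet> a)) \<le> \<epsilon>)"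
proof -
  let ?Y = "dual_group_top A"
  define F where "F n = {\<phi> \<in> topspace ?Y. \<exists>b. norm b \<le> real n \<and> (\<forall>a\<in>A. norm (\<phi> a - circ (b \<bullet> a)) \<le> \<epsilon>)}" for n
  have "(\<lambda>a\<in>group_closure A. 1) \<in> topspace ?Y"
    unfolding topspace_dual_group by (auto simp: group_closure_add)
  then have ne: "topspace ?Y \<noteq> {}"
    by blast
  have "topspace ?Y \<subseteq> \<Union>(range F)"
  proof
    fix \<phi> assume \<phi>: "\<phi> \<in> topspace ?Y"
    then obtain \<beta> :: "'a \<Rightarrow>\<^sub>L real" where \<beta>: "\<And>a. a \<in> A \<Longrightarrow> norm (\<phi> a - circ (\<beta> a)) < \<epsilon>"
      using assms unfolding topspace_dual_group harmonious_def circ_def[symmetric] by blast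
    obtain n where "norm (vec_of \<beta>) \<le> real n"
      using real_arch_simple by blast
    then have "\<phi> \<in> F n"
      unfolding F_def using \<phi> \<beta> by (auto simp: blinfun_apply_eq_inner intro!: exI[of _ "vec_of \<beta>"] less_imp_le)
    then show "\<phi> \<in> \<Union>(range F)"
      by blast
  qed
  then have "\<Union>(range F) = topspace ?Y"
    by (auto simp: F_def)
  have "\<exists>n. ?Y interior_of F n \<noteq> {}"
  proof (rule ccontr)
    assume no: "\<not> ?thesis"
    have "?Y interior_of \<Union>(range F) = {}"
    proof (rule Baire_category_alt)
      show "completely_metrizable_space ?Y \<or> locally_compact_space ?Y \<and> regular_space ?Y"
        using compact_dual_group[of A] Hausdorff_dual_group[of A]
        by (simp add: compact_imp_locally_compact_space compact_Hausdorff_imp_regular_space)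
      show "countable (range F)"
        by simp
      show "closedin ?Y T \<and> ?Y interior_of T = {}" if T: "T \<in> range F" for T
      proof -
        obtain n where "T = F n"
          using T by blast
        then show ?thesis
          using no closedin_near_exponentials[of A "real n" \<epsilon>] unfolding F_def by blast
      qed
    qed
    then show False
      using ne \<open>\<Union>(range F) = topspace ?Y\<close> by simp
  qed
  then obtain n where "?Y interior_of F n \<noteq> {}"
    by blast
  moreover have "?Y interior_of F n \<subseteq> F n"
    by (rule interior_of_subset)
  ultimately show thesis
    using that[of "?Y interior_of F n" n] unfolding F_def by auto
qed

text \<open>A finite net provides \<open>t\<close> whose character is \<open>\<delta>\<close>-close
  to that of \<open>c\<close> on \<open>J\<close>. Twisting \<open>\<phi>0\<close> by the character
  of \<open>c - t\<close> therefore stays in \<open>W\<close>, so \<open>\<phi>0\<close> and its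
  twist are approximated by vectors \<open>b0\<close>, \<open>b1\<close> of norm at most
  \<open>n\<close>. Then \<open>b0 + (c - t) - b1\<close> is nearly trivial on \<open>A\<close> and
  at bounded distance from \<open>c\<close>.\<close>

lemma harmonious_dual_relatively_dense:
  fixes A :: "'a::euclidean_space set"
  assumes "harmonious A" "0 < \<epsilon>"
  obtains K where "\<And>c. \<exists>b. norm (c - b) \<le> K \<and> (\<forall>a\<in>A. norm (circ (b \<bullet> a) - 1) \<le> \<epsilon>)"
proof -
  obtain n :: nat and W where W: "openin (dual_group_top A) W" "W \<noteq> {}"
    "\<And>\<phi>. \<phi> \<in> W \<Longrightarrow> \<exists>b. norm b \<le> n \<and> (\<forall>a\<in>A. norm (\<phi> a - circ (b \<bullet> a)) \<le> \<epsilon> / 2)"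
    using harmonious_uniformly_near[OF assms(1), of "\<epsilon> / 2"] assms(2) by (metis half_gt_zero)
  obtain \<phi>0 where \<phi>0: "\<phi>0 \<in> W"
    using W(2) by blast
  then have \<phi>0': "\<phi>0 \<in> topspace (dual_group_top A)"
    using openin_subset[OF W(1)] by blast
  obtain J \<delta> where J: "finite J" "J \<subseteq> group_closure A" "0 < \<delta>"
    "\<And>\<phi>. \<phi> \<in> topspace (dual_group_top A) \<Longrightarrow> (\<And>g. g \<in> J \<Longrightarrow> norm (\<phi> g - \<phi>0 g) < \<delta>) \<Longrightarrow> \<phi> \<in> W"
    using openin_dual_group_basis[OF W(1) \<phi>0] by blast
  obtain b0 where b0: "norm b0 \<le> n" "\<And>a. a \<in> A \<Longrightarrow> norm (\<phi>0 a - circ (b0 \<bullet> a)) \<le> \<epsilon> / 2"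
    using W(3)[OF \<phi>0] by blast
  obtain T :: "'a set" where T: "finite T" "\<And>c. \<exists>t\<in>T. \<forall>g\<in>J. norm (circ (c \<bullet> g) - circ (t \<bullet> g)) < \<delta>"
    using finite_net_of_bounded_functions[OF J(1,3), of "\<lambda>g c. circ (c \<bullet> g)" UNIV] by auto
  define K where "K = (\<Sum>t\<in>T. norm t) + 2 * real n"
  have "\<exists>b. norm (c - b) \<le> K \<and> (\<forall>a\<in>A. norm (circ (b \<bullet> a) - 1) \<le> \<epsilon>)" for c
  proof -
    obtain t where t: "t \<in> T" "\<And>g. g \<in> J \<Longrightarrow> norm (circ (c \<bullet> g) - circ (t \<bullet> g)) < \<delta>"
      using T(2) by blast
    define \<phi> where "\<phi> = (\<lambda>g\<in>group_closure A. \<phi>0 g * circ ((c - t) \<bullet> g))"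
    have 1: "\<phi> \<in> topspace (dual_group_top A)"
      using \<phi>0' unfolding topspace_dual_group \<phi>_def
      by (auto simp: norm_mult group_closure_add inner_add_right circ_add)
    have 2: "norm (\<phi> g - \<phi>0 g) < \<delta>" if "g \<in> J" for g
    proof -
      have g: "g \<in> group_closure A"
        using that J(2) by blast
      then have "norm (\<phi>0 g) = 1"
        using \<phi>0' unfolding topspace_dual_group by auto
      have "\<phi> g - \<phi>0 g = \<phi>0 g * (circ ((c - t) \<bullet> g) - 1)"
        using g by (simp add: \<phi>_def algebra_simps)
      then have "norm (\<phi> g - \<phi>0 g) = norm (circ ((c - t) \<bullet> g) - 1)"
        using \<open>norm (\<phi>0 g) = 1\<close> by (simp add: norm_mult)
      also have "\<dots> < \<delta>"
        using t(2)[OF that] by (simp add: norm_circ_diff inner_diff_left)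
      finally show ?thesis .
    qed
    obtain b1 where b1: "norm b1 \<le> n" "\<And>a. a \<in> A \<Longrightarrow> norm (\<phi> a - circ (b1 \<bullet> a)) \<le> \<epsilon> / 2"
      using W(3)[OF J(4)[OF 1 2]] by blast
    define b where "b = b0 + (c - t) - b1"
    have "norm (circ (b \<bullet> a) - 1) \<le> \<epsilon>" if a: "a \<in> A" for a
    proof -
      have \<phi>a: "\<phi> a = \<phi>0 a * circ ((c - t) \<bullet> a)"
        using a by (simp add: \<phi>_def group_closure.base)
      have "norm (circ (b \<bullet> a) - 1) = norm (circ ((b0 + (c - t)) \<bullet> a) - circ (b1 \<bullet> a))"
        by (simp add: norm_circ_diff b_def inner_diff_left)
      also have "circ ((b0 + (c - t)) \<bullet> a) - circ (b1 \<bullet> a) =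
          (circ (b0 \<bullet> a) - \<phi>0 a) * circ ((c - t) \<bullet> a) + (\<phi> a - circ (b1 \<bullet> a))"
        unfolding \<phi>a inner_add_left circ_add by (simp add: algebra_simps)
      also have "norm \<dots> \<le> norm (circ (b0 \<bullet> a) - \<phi>0 a) + norm (\<phi> a - circ (b1 \<bullet> a))"
        by (rule order_trans[OF norm_triangle_ineq]) (simp add: norm_mult)
      also have "\<dots> \<le> \<epsilon>"
        using b0(2)[OF a] b1(2)[OF a] by (simp add: norm_minus_commute)
      finally show ?thesis .
    qed
    moreover have "norm (c - b) \<le> K"
    proof -
      have "norm t \<le> (\<Sum>t\<in>T. norm t)"
        using t(1) T(1) by (intro member_le_sum) auto
      moreover have "c - b = t + b1 - b0"
        by (simp add: b_def)
      ultimately show ?thesis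
        using norm_triangle_ineq4[of "t + b1" b0] norm_triangle_ineq[of t b1] b0(1) b1(1)
        unfolding K_def by simp
    qed
    ultimately show ?thesis by blast
  qed
  then show thesis
    using that by blast
qed

section \<open>Nearly integral functionals and their consequences\<close>

lemma harmonious_near_int_dual:
  fixes A :: "'a::euclidean_space set"
  assumes "harmonious A" "0 < \<eta>"
  obtains K where "0 \<le> K" "\<And>c. \<exists>b. norm (c - b) \<le> K \<and> (\<forall>a\<in>A. \<exists>n::int. \<bar>b \<bullet> a - of_int n\<bar> < \<eta>)"
proof -
  obtain e where e: "0 < e" "\<And>y. norm (circ y - 1) < e \<Longrightarrow> \<exists>n::int. \<bar>y - of_int n\<bar> < \<eta>"
    using circ_near_1_imp_near_int'[OF assms(2)] by blast
  obtain K where K: "\<And>c. \<exists>b. norm (c - b) \<le> K \<and> (\<forall>a\<in>A. norm (circ (b \<bullet> a) - 1) \<le> e / 2)"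
    using harmonious_dual_relatively_dense[OF assms(1), of "e / 2"] e(1) by (metis half_gt_zero)
  have *: "\<exists>b. norm (c - b) \<le> K \<and> (\<forall>a\<in>A. \<exists>n::int. \<bar>b \<bullet> a - of_int n\<bar> < \<eta>)" for c
  proof -
    obtain b where "norm (c - b) \<le> K" "\<And>a. a \<in> A \<Longrightarrow> norm (circ (b \<bullet> a) - 1) \<le> e / 2"
      using K by blast
    moreover have "norm (circ (b \<bullet> a) - 1) < e" if "a \<in> A" for a
      using calculation(2)[OF that] e(1) by linarith
    ultimately show ?thesis
      using e(2) by blast
  qed
  moreover have "0 \<le> K"
    using *[of 0] norm_ge_zero order_trans by blast
  ultimately show thesis
    using that by blast
qed

text \<open>Let \<open>v = a - a'\<close> be short and nonzero, and let \<open>c\<close> pair with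
  \<open>v\<close> to \<open>1 / 2\<close>. A nearly integral \<open>b\<close> within
  \<open>K\<close> of \<open>c\<close> pairs with \<open>v\<close> to a value strictly between
  \<open>1 / 4\<close> and \<open>3 / 4\<close>, yet near-integrality at \<open>a\<close> and
  \<open>a'\<close> puts that value within \<open>1 / 4\<close> of an integer.\<close>

lemma harmonious_imp_uniform_discrete:
  fixes A :: "'a::euclidean_space set"
  assumes "harmonious A"
  shows "uniform_discrete A"
proof -
  obtain K where K: "0 \<le> K" "\<And>c. \<exists>b. norm (c - b) \<le> K \<and> (\<forall>a\<in>A. \<exists>n::int. \<bar>b \<bullet> a - of_int n\<bar> < 1 / 8)"
    using harmonious_near_int_dual[OF assms, of "1 / 8"] by auto
  have "a = a'" if a: "a \<in> A" "a' \<in> A" "dist a a' < 1 / (4 * (K + 1))" for a a'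
  proof (rule ccontr)
    assume "a \<noteq> a'"
    define v where "v = a - a'"
    have v: "0 < norm v" "norm v < 1 / (4 * (K + 1))"
      using a(3) \<open>a \<noteq> a'\<close> by (auto simp: v_def dist_norm)
    define c where "c = (1 / (2 * (norm v)\<^sup>2)) *\<^sub>R v"
    have c: "c \<bullet> v = 1 / 2"
      using v(1) by (simp add: c_def power2_norm_eq_inner[symmetric])
    obtain b where b: "norm (c - b) \<le> K" "\<forall>a\<in>A. \<exists>n::int. \<bar>b \<bullet> a - of_int n\<bar> < 1 / 8"
      using K(2) by blast
    obtain m n :: int where mn: "\<bar>b \<bullet> a - of_int m\<bar> < 1 / 8" "\<bar>b \<bullet> a' - of_int n\<bar> < 1 / 8"
      using b(2) a by blast
    have "\<bar>(c - b) \<bullet> v\<bar> \<le> norm (c - b) * norm v"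
      by (rule Cauchy_Schwarz_ineq2)
    also have "\<dots> \<le> K * norm v"
      using b(1) by (intro mult_right_mono) auto
    also have "\<dots> \<le> (K + 1) * norm v"
      by (intro mult_right_mono) auto
    also have "\<dots> < 1 / 4"
      using v(2) K(1) by (simp add: field_simps)
    finally have "\<bar>1 / 2 - b \<bullet> v\<bar> < 1 / 4"
      by (simp add: inner_diff_left c)
    moreover have "b \<bullet> v = b \<bullet> a - b \<bullet> a'"
      by (simp add: v_def inner_diff_right)
    ultimately have "0 < of_int (m - n) + (0::real)" "of_int (m - n) < (1::real)"
      using mn by (auto simp: abs_if split: if_splits)
    then show False by simp
  qed
  moreover have "0 < 1 / (4 * (K + 1))"
    using K(1) by simp
  ultimately show ?thesis
    unfolding uniform_discrete_def by blast
qed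

text \<open>The hypothesis \<open>1 / 4\<close> makes the second differences of the fractional part \<open>g\<close> integers of
  absolute value below \<open>1\<close>, hence zero: the increments of \<open>g\<close> depend only on the displacement.\<close>

lemma returns_near_int_if_near_int:
  fixes A :: "'a::euclidean_space set"
  assumes "recurrent A" "A \<noteq> {}" and near: "\<And>a. a \<in> A \<Longrightarrow> \<exists>n::int. \<bar>b \<bullet> a - of_int n\<bar> < 1 / 4"
  shows "returns_near_int A ((\<bullet>) b)"
  unfolding returns_near_int_def
proof (intro allI impI)
  fix \<eta> :: real assume "0 < \<eta>"
  obtain N :: "'a \<Rightarrow> int" where N: "\<And>a. a \<in> A \<Longrightarrow> \<bar>b \<bullet> a - of_int (N a)\<bar> < 1 / 4"
    using near by metis
  define g where "g a = b \<bullet> a - of_int (N a)" for a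
  have g: "\<bar>g a\<bar> < 1 / 4" if "a \<in> A" for a
    using N[OF that] by (simp add: g_def)
  have par: "g (x + w) - g x = g (y + w) - g y" if "x \<in> A" "y \<in> A" "x + w \<in> A" "y + w \<in> A" for x y w
  proof -
    let ?k = "N x - N (x + w) - (N y - N (y + w))"
    have "(g (x + w) - g x) - (g (y + w) - g y) = of_int ?k"
      by (simp add: g_def inner_add_right)
    moreover have "\<bar>(g (x + w) - g x) - (g (y + w) - g y)\<bar> < 1"
      using g[OF that(1)] g[OF that(2)] g[OF that(3)] g[OF that(4)] by linarith
    ultimately have "?k = 0"
      by linarith
    then show ?thesis
      using \<open>_ = of_int ?k\<close> by simp
  qed
  have "bdd_above (g ` A)"
    using g by (intro bdd_aboveI2[of _ _ "1/4"]) (fastforce simp: abs_less_iff)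
  moreover have "bdd_below (g ` A)"
    using g by (intro bdd_belowI2[of _ "-1/4"]) (fastforce simp: abs_less_iff)
  ultimately have bdd: "bdd_above (g ` A)" "bdd_below (g ` A)"
    by auto
  define s where "s = Sup (g ` A)"
  define i where "i = Inf (g ` A)"
  have s: "g a \<le> s" if "a \<in> A" for a
    unfolding s_def using that bdd(1) by (simp add: cSUP_upper)
  have i: "i \<le> g a" if "a \<in> A" for a
    unfolding i_def using that bdd(2) by (simp add: cINF_lower)
  obtain x0 where x0: "x0 \<in> A" "s - \<eta> / 3 < g x0"
    using less_cSupE[of "s - \<eta> / 3" "g ` A"] \<open>0 < \<eta>\<close> assms(2) by (auto simp: s_def)
  obtain x1 where x1: "x1 \<in> A" "g x1 < i + \<eta> / 6"
    using cInf_lessD[of "g ` A" "i + \<eta> / 6"] \<open>0 < \<eta>\<close> assms(2) by (auto simp: i_def)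
  define w where "w = x1 - x0"
  \<comment> \<open>The increment \<open>g (t + w) - g t\<close> equals \<open>g x1 - g x0\<close>,
    which is nearly the least conceivable value \<open>i - s\<close>; this leaves room only for
    \<open>g t\<close> near the supremum.\<close>
  have big: "s - \<eta> / 2 < g t" if "t \<in> A" "t + w \<in> A" for t
    using par[of x0 t w] i[OF that(2)] that x0 x1 by (simp add: w_def)
  obtain K where K: "\<And>u. \<exists>t. norm (u - t) \<le> K \<and> alike A (norm w) x0 t"
    using assms(1) unfolding recurrent_def by meson
  \<comment> \<open>A copy of the pair \<open>x0\<close>, \<open>x1\<close> near \<open>u\<close> is
    carried along by \<open>v - u\<close>. At both base points \<open>g\<close> is within
    \<open>\<eta> / 2\<close> of its supremum, and its change equals
    \<open>b \<bullet> (v - u)\<close> up to an integer.\<close>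
  have "\<exists>n::int. \<bar>b \<bullet> (v - u) - of_int n\<bar> < \<eta>" if uv: "alike A (K + norm w) u v" for u v
  proof -
    obtain t where t: "norm (u - t) \<le> K" "alike A (norm w) x0 t"
      using K by blast
    have tA: "t \<in> A" "t + w \<in> A"
      using alike_at[OF t(2), of x0] alike_at[OF t(2), of x1] x0(1) x1(1) by (auto simp: w_def algebra_simps)
    have "norm (t - u) \<le> K + norm w" "norm (t + w - u) \<le> K + norm w"
      using t(1) norm_triangle_ineq[of "t - u" w] by (auto simp: norm_minus_commute algebra_simps intro: add_increasing2)
    then have tA': "t + (v - u) \<in> A" "t + (v - u) + w \<in> A"
      using alike_at[OF uv, of t] alike_at[OF uv, of "t + w"] tA by (auto simp: algebra_simps)
    have "\<bar>g (t + (v - u)) - g t\<bar> < \<eta>"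
      using big[OF tA] big[OF tA'] s[OF tA(1)] s[OF tA'(1)] \<open>0 < \<eta>\<close> by linarith
    moreover have "g (t + (v - u)) - g t = b \<bullet> (v - u) - of_int (N (t + (v - u)) - N t)"
      by (simp add: g_def inner_add_right)
    ultimately show ?thesis by metis
  qed
  then show "\<exists>R. \<forall>u v. alike A R u v \<longrightarrow> (\<exists>n::int. \<bar>b \<bullet> (v - u) - of_int n\<bar> < \<eta>)"
    by blast
qed

text \<open>If the eigenvalues did not span the dual, some nonzero \<open>v\<close> would be
  annihilated by all of them. A spanning set contains a basis.\<close>

lemma full_rank_if_separating:
  fixes A :: "'a::euclidean_space set"
  assumes "\<And>v. v \<noteq> 0 \<Longrightarrow> \<exists>\<beta>. topological_eigenvalue A \<beta> \<and> blinfun_apply \<beta> v \<noteq> 0"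
  shows "has_full_rank_eigenvalues A"
proof -
  define E where "E = vec_of ` Collect (topological_eigenvalue A)"
  have sp: "span E = UNIV"
  proof (rule ccontr)
    assume "span E \<noteq> UNIV"
    then obtain v where v: "v \<noteq> 0" "\<forall>x\<in>span E. v \<bullet> x = 0"
      using span_not_UNIV_orthogonal by blast
    obtain \<beta> where "topological_eigenvalue A \<beta>" "blinfun_apply \<beta> v \<noteq> 0"
      using assms v(1) by blast
    then show False
      using v(2) by (auto simp: E_def blinfun_apply_eq_inner inner_commute span_base)
  qed
  obtain B where B: "B \<subseteq> E" "independent B" "E \<subseteq> span B"
    using maximal_independent_subset[of E] by blast
  have spB: "span B = UNIV"
    using sp B(3) by (metis span_mono span_span top.extremum_uniqueI)
  define S where "S = blinfun_inner_left ` B"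
  have inj: "inj (blinfun_inner_left :: 'a \<Rightarrow> 'a \<Rightarrow>\<^sub>L real)"
    by (rule injI) (metis blinfun_inner_left.rep_eq vector_eq_rdot inner_commute)
  have "card S = card B"
    unfolding S_def using inj by (intro card_image) (rule inj_on_subset, auto)
  also have "card B = DIM('a)"
    using B(2) spB dim_eq_card[of B UNIV] by (simp add: dim_UNIV)
  finally have "card S = DIM('a)" .
  moreover have "independent S"
    unfolding S_def using B(2) inj
    by (intro real_vector.linear_independent_injective_image)
      (auto intro: inj_on_subset bounded_linear.linear bounded_linear_blinfun_inner_left)
  moreover have "finite S"
    unfolding S_def using B(2) by (simp add: independent_imp_finite)
  moreover have "S \<subseteq> Collect (topological_eigenvalue A)"
  proof -
    have "blinfun_inner_left (vec_of \<beta>) = \<beta>" for \<beta> :: "'a \<Rightarrow>\<^sub>L real"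
      by (rule blinfun_eqI) (simp add: blinfun_apply_eq_inner inner_commute)
    then show ?thesis
      using B(1) unfolding S_def E_def by auto
  qed
  ultimately show ?thesis
    unfolding has_full_rank_eigenvalues_def by blast
qed

lemma meyer_recurrent_full_rank:
  fixes A :: "'a::euclidean_space set"
  assumes "meyer A" "recurrent A"
  shows "has_full_rank_eigenvalues A"
proof (rule full_rank_if_separating)
  fix v :: 'a assume "v \<noteq> 0"
  have harm: "harmonious A" and ne: "A \<noteq> {}"
    using assms(1) unfolding meyer_def relatively_dense_def by auto
  obtain K where "0 \<le> K" and K: "\<And>c. \<exists>b. norm (c - b) \<le> K \<and> (\<forall>a\<in>A. \<exists>n::int. \<bar>b \<bullet> a - of_int n\<bar> < 1 / 4)"
    using harmonious_near_int_dual[OF harm, of "1 / 4"] by auto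
  \<comment> \<open>A vector within \<open>K\<close> of the vector of length \<open>K + 1\<close>
    along \<open>v\<close> cannot be orthogonal to \<open>v\<close>.\<close>
  obtain b where b: "norm (((K + 1) / norm v) *\<^sub>R v - b) \<le> K" "\<And>a. a \<in> A \<Longrightarrow> \<exists>n::int. \<bar>b \<bullet> a - of_int n\<bar> < 1 / 4"
    using K by blast
  have "b \<bullet> v \<noteq> 0"
  proof
    assume "b \<bullet> v = 0"
    have "(K + 1) * norm v = (((K + 1) / norm v) *\<^sub>R v - b) \<bullet> v"
      using \<open>v \<noteq> 0\<close> \<open>b \<bullet> v = 0\<close> by (simp add: inner_diff_left power2_norm_eq_inner[symmetric] power2_eq_square)
    also have "\<dots> \<le> norm (((K + 1) / norm v) *\<^sub>R v - b) * norm v"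
      by (rule norm_cauchy_schwarz)
    also have "\<dots> \<le> K * norm v"
      using b(1) by (intro mult_right_mono) auto
    finally show False
      using \<open>v \<noteq> 0\<close> by simp
  qed
  moreover have "topological_eigenvalue A (blinfun_inner_left b)"
  proof (rule eigenvalue_if_returns_near_int)
    show "closed A"
      using harmonious_imp_uniform_discrete[OF harm] uniform_discrete_imp_closed by blast
    have "blinfun_apply (blinfun_inner_left b) = (\<bullet>) b"
      by (auto simp: inner_commute)
    then show "returns_near_int A (blinfun_apply (blinfun_inner_left b))"
      using returns_near_int_if_near_int[OF assms(2) ne b(2)] by simp
  qed
  ultimately show "\<exists>\<beta>. topological_eigenvalue A \<beta> \<and> blinfun_apply \<beta> v \<noteq> 0"
    by (intro exI[of _ "blinfun_inner_left b"]) (simp add: inner_commute)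
qed

section \<open>Transfer along conjugacies\<close>

text \<open>Approximate \<open>\<omega>\<close> by \<open>translate A x\<close> and
  \<open>translate \<omega> v\<close> by \<open>translate A y\<close>. The patch at \<open>x\<close>
  recurs at some \<open>t\<close> within \<open>K\<close> of \<open>y\<close>, and
  \<open>translate \<omega> (v + (t - y))\<close> is close to \<open>translate A t\<close>, hence to
  \<open>translate A x\<close>, hence to \<open>\<omega>\<close>. Since \<open>x\<close> is chosen
  before \<open>v\<close>, the bound \<open>K\<close> is uniform.\<close>

lemma hull_almost_periodic:
  fixes A :: "'a::euclidean_space set"
  assumes "closed A" "recurrent A" "\<omega> \<in> hull_of A" "0 < e"
  obtains K where "\<And>v. \<exists>t. norm (v - t) \<le> K \<and> tiling_dist (translate \<omega> t) \<omega> < e"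
proof -
  obtain x where x: "tiling_dist (translate A x) \<omega> < e / 3"
    using hull_approx[OF assms(1,3), of "e / 3"] assms(4) by auto
  obtain K where K: "\<And>v. \<exists>t. norm (v - t) \<le> K \<and> alike A (4 / e) x t"
    using assms(2) unfolding recurrent_def by meson
  obtain \<delta> where \<delta>: "0 < \<delta>" "\<forall>(A::'a set) B r. norm r \<le> K \<longrightarrow> tiling_dist A B < \<delta> \<longrightarrow>
    tiling_dist (translate A r) (translate B r) < e / 3"
    using tiling_dist_translate_small[of "e / 3" K] assms(4) by auto
  have "\<exists>t. norm (v - t) \<le> K \<and> tiling_dist (translate \<omega> t) \<omega> < e" for v
  proof -
    obtain y where y: "tiling_dist (translate A y) (translate \<omega> v) < \<delta>"
      using hull_approx[OF assms(1) translate_hull_closed[OF assms(1,3), of v] \<delta>(1)] by blast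
    obtain t where t: "norm (y - t) \<le> K" "alike A (4 / e) x t"
      using K by blast
    have "norm (t - y) \<le> K"
      using t(1) by (simp add: norm_minus_commute)
    then have "tiling_dist (translate (translate A y) (t - y)) (translate (translate \<omega> v) (t - y)) < e / 3"
      using \<delta>(2) y by blast
    then have 1: "tiling_dist (translate A t) (translate \<omega> (v + (t - y))) < e / 3"
      by simp
    have "tiling_dist (translate A x) (translate A t) \<le> 1 / (4 / e)"
      using assms(4) by (intro alike_imp_tiling_dist[OF t(2)]) simp
    then have 2: "tiling_dist (translate A x) (translate A t) < e / 3"
      using assms(4) by simp
    have "tiling_dist (translate \<omega> (v + (t - y))) \<omega> < e"
      using 1 2 x tiling_dist_triangle[of "translate \<omega> (v + (t - y))" \<omega> "translate A t"]
        tiling_dist_triangle[of "translate A t" \<omega> "translate A x"]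
        tiling_dist_commute[of "translate A t" "translate \<omega> (v + (t - y))"]
        tiling_dist_commute[of "translate A t" "translate A x"]
      by linarith
    then show ?thesis
      using t(1) by (intro exI[of _ "v + (t - y)"]) simp
  qed
  then show thesis
    using that by blast
qed

lemma topologically_conjugateE:
  fixes A B :: "'a::euclidean_space set"
  assumes "topologically_conjugate A B"
  obtains h where "continuous_map (hull_topology A) (hull_topology B) h" "h ` hull_of A = hull_of B"
    "\<And>\<omega> t. \<omega> \<in> hull_of A \<Longrightarrow> h (translate \<omega> t) = translate (h \<omega>) t"
proof -
  obtain h where h: "homeomorphic_map (hull_topology A) (hull_topology B) h"
    "\<forall>t. \<forall>\<omega>\<in>hull_of A. h (translate \<omega> t) = translate (h \<omega>) t"
    using assms unfolding topologically_conjugate_def by blast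
  have "h ` hull_of A = hull_of B"
    using homeomorphic_imp_surjective_map[OF h(1)] by simp
  then show thesis
    using that homeomorphic_imp_continuous_map[OF h(1)] h(2) by blast
qed

lemma eigenvalue_conjugate:
  fixes A B :: "'a::euclidean_space set"
  assumes "topologically_conjugate A B" "topological_eigenvalue B \<beta>"
  shows "topological_eigenvalue A \<beta>"
proof -
  obtain h where h: "continuous_map (hull_topology A) (hull_topology B) h" "h ` hull_of A = hull_of B"
    "\<And>\<omega> t. \<omega> \<in> hull_of A \<Longrightarrow> h (translate \<omega> t) = translate (h \<omega>) t"
    using topologically_conjugateE[OF assms(1)] by blast
  obtain f where f: "continuous_map (hull_topology B) euclidean f" "\<exists>\<omega>\<in>hull_of B. f \<omega> \<noteq> 0"
    "\<And>t \<omega>. \<omega> \<in> hull_of B \<Longrightarrow> f (translate \<omega> t) = circ (\<beta> t) * f \<omega>"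
    using assms(2) unfolding topological_eigenvalue_def circ_def[symmetric] by blast
  show ?thesis
    unfolding topological_eigenvalue_def circ_def[symmetric]
  proof (intro exI[of _ "f \<circ> h"] conjI allI ballI)
    show "continuous_map (hull_topology A) euclidean (f \<circ> h)"
      using h(1) f(1) by (rule continuous_map_compose)
    show "\<exists>\<omega>\<in>hull_of A. (f \<circ> h) \<omega> \<noteq> 0"
      using f(2) h(2) by (metis comp_apply imageE)
    show "(f \<circ> h) (translate \<omega> t) = circ (\<beta> t) * (f \<circ> h) \<omega>" if "\<omega> \<in> hull_of A" for t \<omega>
    proof -
      have "h \<omega> \<in> hull_of B"
        using h(2) that by blast
      then show ?thesis
        using h(3)[OF that] f(3) by simp
    qed
  qed
qed

text \<open>The preimage \<open>\<omega>\<close> of \<open>B\<close> need not lie on the orbit of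
  \<open>A\<close>, which is why almost periodicity was proved for all hull points. Equivariance and
  continuity at \<open>\<omega>\<close> pass it on to \<open>B\<close>, and metric closeness is
  turned back into exact agreement by the shifts \<open>a\<close>, \<open>b\<close>.\<close>

lemma recurrent_conjugate:
  fixes A B :: "'a::euclidean_space set"
  assumes "closed A" "closed B" "recurrent A" "topologically_conjugate A B"
  shows "recurrent B"
  unfolding recurrent_def
proof (intro allI)
  fix R :: real and u :: 'a
  obtain h where h: "continuous_map (hull_topology A) (hull_topology B) h" "h ` hull_of A = hull_of B"
    "\<And>\<omega> t. \<omega> \<in> hull_of A \<Longrightarrow> h (translate \<omega> t) = translate (h \<omega>) t"
    using topologically_conjugateE[OF assms(4)] by blast
  have "B \<in> hull_of B"
    using translate_in_hull[OF assms(2), of 0] by simp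
  then obtain \<omega> where \<omega>: "\<omega> \<in> hull_of A" "h \<omega> = B"
    using h(2) by (metis imageE)
  \<comment> \<open>Room for the radius \<open>R\<close>, for recentring by \<open>u - a\<close>
    with \<open>norm a \<le> 1\<close>, and for \<open>1 \<le> r\<close>.\<close>
  define r where "r = \<bar>R\<bar> + norm u + 2"
  have r: "1 \<le> r" "0 < 1 / r" "1 / r \<le> 1"
    unfolding r_def by (auto simp: add_nonneg_pos field_simps)
  have "continuous_map (hull_topology A) tiling.mtopology h"
    using h(1) unfolding hull_topology_def[of B] by (rule continuous_map_into_fulltopology)
  moreover have "h \<in> hull_of A \<rightarrow> Collect closed"
    using h(2) hull_subset_closed by blast
  ultimately obtain \<delta> where \<delta>: "0 < \<delta>"
    "\<And>\<omega>'. \<omega>' \<in> hull_of A \<Longrightarrow> tiling_dist \<omega> \<omega>' < \<delta> \<Longrightarrow> tiling_dist B (h \<omega>') < 1 / r"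
    using continuous_map_hull_into_tiling_iff \<omega> r(2) by metis
  obtain K where K: "\<And>v. \<exists>t. norm (v - t) \<le> K \<and> tiling_dist (translate \<omega> t) \<omega> < \<delta>"
    using hull_almost_periodic[OF assms(1,3) \<omega>(1) \<delta>(1)] by blast
  have "\<exists>t. norm (v - t) \<le> K + 1 \<and> alike B R u t" for v
  proof -
    obtain t where t: "norm (v - u - t) \<le> K" "tiling_dist (translate \<omega> t) \<omega> < \<delta>"
      using K by blast
    have "tiling_dist B (translate B t) < 1 / r"
      using \<delta>(2)[OF translate_hull_closed[OF assms(1) \<omega>(1), of t]] t(2) h(3)[OF \<omega>(1), of t] \<omega>(2)
      by (simp add: tiling_dist_commute)
    then have "tiling_dist (translate B 0) (translate B t) < 1 / r"
      by simp
    then obtain a b where ab: "norm a + norm b \<le> 1 / r" "alike B (1 / (1 / r)) (0 + a) (t + b)"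
      using tiling_dist_imp_alike r(3) by blast
    have n1: "norm a + norm b \<le> 1"
      using ab(1) r(3) by linarith
    then have na: "norm a \<le> 1"
      using norm_ge_zero[of b] by linarith
    have "alike B R (0 + a + (u - a)) (t + b + (u - a))"
      using ab(2) by (rule alike_shift) (use na norm_triangle_ineq4[of u a] in \<open>simp add: r_def\<close>)
    moreover have "norm (v - (t + b + (u - a))) \<le> K + 1"
    proof -
      have eq: "v - (t + b + (u - a)) = (v - u - t) + (a - b)"
        by simp
      show ?thesis
        unfolding eq
        using norm_triangle_ineq[of "v - u - t" "a - b"] norm_triangle_ineq4[of a b] n1 t(1) by linarith
    qed
    ultimately show ?thesis
      by (intro exI[of _ "t + b + (u - a)"]) simp
  qed
  then show "\<exists>K. \<forall>v. \<exists>t. norm (v - t) \<le> K \<and> alike B R u t"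
    by blast
qed

lemma closed_if_meyer:
  fixes A :: "'a::euclidean_space set"
  assumes "meyer A"
  shows "closed A"
  using assms harmonious_imp_uniform_discrete uniform_discrete_imp_closed unfolding meyer_def by blast

lemma full_rank_if_conjugate_meyer:
  fixes A B :: "'a::euclidean_space set"
  assumes "closed A" "recurrent A" "meyer B" "topologically_conjugate A B"
  shows "has_full_rank_eigenvalues A"
proof -
  have "has_full_rank_eigenvalues B"
    using meyer_recurrent_full_rank recurrent_conjugate closed_if_meyer assms by blast
  then show ?thesis
    unfolding has_full_rank_eigenvalues_def using eigenvalue_conjugate[OF assms(4)] by blast
qed

section \<open>Coding a Delone set by lattice points\<close>

lemma norm_le_add: "x = y + z \<Longrightarrow> norm x \<le> norm y + norm z" for x :: "'a::real_normed_vector"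
  by (simp add: norm_triangle_ineq)

lemma norm_le_diff: "x = y - z \<Longrightarrow> norm x \<le> norm y + norm z" for x :: "'a::real_normed_vector"
  by (simp add: norm_triangle_ineq4)

text \<open>Moved to the origin, so that equal values mean equal patches with matching centres; this
  makes it usable as the colour of a point.\<close>

definition centred_patch :: "'a::euclidean_space set \<Rightarrow> real \<Rightarrow> 'a \<Rightarrow> 'a set"
  where "centred_patch A R x = {z. norm z \<le> R \<and> z + x \<in> A}"

lemma centred_patch_eq_iff: "centred_patch A R x = centred_patch A R y \<longleftrightarrow> alike A R x y"
  unfolding centred_patch_def alike_def by blast

text \<open>The offsets in \<open>Q0\<close> are attached to every lattice point; they make the coding set generate the
  finer lattice. The offset \<open>q c\<close> marks the presence of the patch \<open>c\<close>. The condition \<open>Q_add\<close> excludes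
  that the coding set locally has a period outside \<open>L\<close>, and \<open>Q_diff\<close> makes offsets readable.\<close>

locale lattice_coding =
  fixes \<Lambda> L Q0 :: "'a::euclidean_space set" and q :: "'a set \<Rightarrow> 'a"
    and \<rho> D r a R0 e0 :: real
  assumes L_zero: "0 \<in> L" and L_diff: "\<And>x y. x \<in> L \<Longrightarrow> y \<in> L \<Longrightarrow> x - y \<in> L"
    and L_sep: "\<And>l. l \<in> L \<Longrightarrow> norm l < \<rho> \<Longrightarrow> l = 0"
    and L_dense: "\<And>x. \<exists>l\<in>L. norm (x - l) \<le> D"
    and \<Lambda>_sep: "\<And>x y. x \<in> \<Lambda> \<Longrightarrow> y \<in> \<Lambda> \<Longrightarrow> norm (x - y) < r \<Longrightarrow> x = y"
    and \<Lambda>_dense: "\<And>x. \<exists>y\<in>\<Lambda>. norm (x - y) \<le> a"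
    and a_pos: "0 < a" and R0: "3 * a \<le> R0"
    and e0: "0 < e0" "4 * e0 \<le> r" "4 * e0 \<le> \<rho>"
    and L_near: "\<And>e. 0 < e \<Longrightarrow> \<exists>R. \<forall>u v. alike \<Lambda> R u v \<longrightarrow> (\<exists>l\<in>L. norm (v - u - l) < e)"
    and L_near_R0: "\<And>u v. alike \<Lambda> R0 u v \<Longrightarrow> \<exists>l\<in>L. norm (v - u - l) < e0"
    and fin_Q0: "finite Q0" and Q0_zero: "0 \<in> Q0"
    and fin_colours: "finite (centred_patch \<Lambda> R0 ` \<Lambda>)"
    and q_inj: "inj_on q (centred_patch \<Lambda> R0 ` \<Lambda>)"
    and q_Q0: "\<And>x. x \<in> \<Lambda> \<Longrightarrow> q (centred_patch \<Lambda> R0 x) \<notin> Q0"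
    and Q_add: "\<And>s t. s \<in> Q0 \<union> q ` centred_patch \<Lambda> R0 ` \<Lambda> \<Longrightarrow>
      t \<in> Q0 \<union> q ` centred_patch \<Lambda> R0 ` \<Lambda> \<Longrightarrow> s + t \<in> L \<Longrightarrow> s = 0"
    and Q_diff: "\<And>s t. s \<in> Q0 \<union> q ` centred_patch \<Lambda> R0 ` \<Lambda> \<Longrightarrow>
      t \<in> Q0 \<union> q ` centred_patch \<Lambda> R0 ` \<Lambda> \<Longrightarrow> s - t \<in> L \<Longrightarrow> s = t"
begin

abbreviation colour :: "'a \<Rightarrow> 'a set"
  where "colour \<equiv> centred_patch \<Lambda> R0"

definition Q :: "'a set"
  where "Q = Q0 \<union> q ` colour ` \<Lambda>"

text \<open>A reference point of each colour: all points of colour \<open>c\<close> lie within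
  \<open>e0\<close> of \<open>centre c + L\<close>.\<close>

definition centre :: "'a set \<Rightarrow> 'a"
  where "centre c = (SOME x. x \<in> \<Lambda> \<and> colour x = c)"

definition near_lattice :: "'a \<Rightarrow> 'a"
  where "near_lattice x = (SOME l. l \<in> L \<and> norm (x - centre (colour x) - l) < e0)"

text \<open>Trades the coset of \<open>centre (colour x)\<close>, near which \<open>x\<close> lies,
  for the coset of \<open>q (colour x)\<close>, and keeps the lattice component.\<close>

definition code_pt :: "'a \<Rightarrow> 'a"
  where "code_pt x = near_lattice x + q (colour x)"

definition code :: "'a set"
  where "code = {l + s | l s. l \<in> L \<and> s \<in> Q0} \<union> code_pt ` \<Lambda>"

lemma L_uminus: "x \<in> L \<Longrightarrow> - x \<in> L"
  using L_diff[OF L_zero, of x] by simp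

lemma L_add: "x \<in> L \<Longrightarrow> y \<in> L \<Longrightarrow> x + y \<in> L"
  using L_diff[of x "- y"] L_uminus by simp

lemma L_eq: "x \<in> L \<Longrightarrow> y \<in> L \<Longrightarrow> norm (x - y) < \<rho> \<Longrightarrow> x = y"
  using L_sep[OF L_diff, of x y] by simp

lemma centre: "x \<in> \<Lambda> \<Longrightarrow> centre (colour x) \<in> \<Lambda> \<and> colour (centre (colour x)) = colour x"
  unfolding centre_def by (rule someI[of _ x]) simp

lemma near_lattice:
  assumes "x \<in> \<Lambda>"
  shows "near_lattice x \<in> L" "norm (x - centre (colour x) - near_lattice x) < e0"
proof -
  have "alike \<Lambda> R0 (centre (colour x)) x"
    using centre[OF assms] centred_patch_eq_iff by blast
  then obtain l where "l \<in> L \<and> norm (x - centre (colour x) - l) < e0"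
    using L_near_R0 by blast
  then have "near_lattice x \<in> L \<and> norm (x - centre (colour x) - near_lattice x) < e0"
    unfolding near_lattice_def by (rule someI)
  then show "near_lattice x \<in> L" "norm (x - centre (colour x) - near_lattice x) < e0"
    by auto
qed

text \<open>The tolerance \<open>2 * e0\<close> admits a lattice vector inherited from another point
  of the same colour; uniqueness survives because \<open>3 * e0\<close> is still below
  \<open>\<rho>\<close>.\<close>

lemma near_lattice_eqI:
  assumes "x \<in> \<Lambda>" "l \<in> L" "norm (x - centre (colour x) - l) < 2 * e0"
  shows "near_lattice x = l"
proof (rule L_eq)
  have "norm (near_lattice x - l) \<le>
      norm (x - centre (colour x) - l) + norm (x - centre (colour x) - near_lattice x)"
    by (rule norm_le_diff) simp
  then show "norm (near_lattice x - l) < \<rho>"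
    using near_lattice(2)[OF assms(1)] assms(3) e0 by linarith
qed (use near_lattice(1) assms in auto)

lemma code_pt_bounded:
  obtains C where "0 \<le> C" "\<And>x. x \<in> \<Lambda> \<Longrightarrow> norm (x - code_pt x) \<le> C"
proof -
  have fin: "finite (colour ` \<Lambda>)"
    by (rule fin_colours)
  define C where "C = e0 + (\<Sum>c\<in>colour ` \<Lambda>. norm (centre c - q c))"
  have "norm (x - code_pt x) \<le> C" if "x \<in> \<Lambda>" for x
  proof -
    have "norm (centre (colour x) - q (colour x)) \<le> (\<Sum>c\<in>colour ` \<Lambda>. norm (centre c - q c))"
      using fin that by (intro member_le_sum) auto
    moreover have "norm (x - code_pt x) \<le>
        norm (x - centre (colour x) - near_lattice x) + norm (centre (colour x) - q (colour x))"
      by (rule norm_le_add) (simp add: code_pt_def)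
    ultimately show ?thesis
      unfolding C_def using near_lattice(2)[OF that] by linarith
  qed
  moreover have "0 \<le> C"
    unfolding C_def using e0(1) by (simp add: sum_nonneg)
  ultimately show thesis
    using that by blast
qed

lemma L_subset_code: "L \<subseteq> code"
proof
  fix l assume "l \<in> L"
  then have "l + 0 \<in> {l + s | l s. l \<in> L \<and> s \<in> Q0}"
    using Q0_zero by blast
  then show "l \<in> code"
    by (simp add: code_def)
qed

lemma code_cases:
  assumes "y \<in> code"
  obtains l s where "y = l + s" "l \<in> L" "s \<in> Q" "s \<in> Q0 \<or> (\<exists>x\<in>\<Lambda>. l = near_lattice x \<and> s = q (colour x))"
  using assms near_lattice(1) unfolding code_def code_pt_def Q_def by blast

text \<open>A code point made from \<open>x\<close> reappears as the one made from
  \<open>x + (v - u)\<close>, which has the same colour. Its lattice component is within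
  \<open>2 * e0\<close> of \<open>near_lattice x + l\<close> and so equals it: the code moves by
  exactly \<open>l\<close>, although \<open>v - u\<close> is only near \<open>l\<close>. In the
  radius, \<open>C\<close> covers the distance from \<open>x\<close> to its code point and
  \<open>R0\<close> the reading of its colour.\<close>

lemma code_forward:
  assumes C: "\<And>x. x \<in> \<Lambda> \<Longrightarrow> norm (x - code_pt x) \<le> C"
    and uv: "alike \<Lambda> R u v" and l: "l \<in> L" "norm (v - u - l) < e0"
    and y: "y \<in> code" "norm (y - u) + C + R0 \<le> R"
  shows "y + l \<in> code"
proof (cases "y \<in> code_pt ` \<Lambda>")
  case False
  then obtain l' s where ls: "y = l' + s" "l' \<in> L" "s \<in> Q0"
    using y(1) unfolding code_def by blast
  then have "y + l = (l' + l) + s"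
    by simp
  then show ?thesis
    using ls L_add[OF ls(2) l(1)] unfolding code_def by blast
next
  case True
  then obtain x where x: "x \<in> \<Lambda>" "y = code_pt x"
    by blast
  have "x - u = (x - code_pt x) + (y - u)"
    using x(2) by simp
  then have xu: "norm (x - u) \<le> C + norm (y - u)"
    using norm_triangle_ineq[of "x - code_pt x" "y - u"] C[OF x(1)] by simp
  define x' where "x' = x + (v - u)"
  have R0_pos: "0 \<le> R0"
    using R0 a_pos by linarith
  have "x' \<in> \<Lambda>"
    using alike_at[OF uv, of x] x(1) xu y(2) R0_pos by (simp add: x'_def)
  have "alike \<Lambda> R0 (u + (x - u)) (v + (x - u))"
    using uv by (rule alike_shift) (use xu y(2) in linarith)
  then have "alike \<Lambda> R0 x x'"
    by (simp add: x'_def algebra_simps)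
  then have col: "colour x' = colour x"
    using centred_patch_eq_iff by metis
  have "norm (x' - centre (colour x') - (near_lattice x + l)) \<le>
      norm (x - centre (colour x) - near_lattice x) + norm (v - u - l)"
    unfolding col by (rule norm_le_add) (simp add: x'_def)
  then have "norm (x' - centre (colour x') - (near_lattice x + l)) < 2 * e0"
    using near_lattice(2)[OF x(1)] l(2) by linarith
  then have "near_lattice x' = near_lattice x + l"
    using near_lattice_eqI[OF \<open>x' \<in> \<Lambda>\<close> L_add[OF near_lattice(1)[OF x(1)] l(1)]] by simp
  then have "y + l = code_pt x'"
    using x(2) col by (simp add: code_pt_def)
  then show ?thesis
    using \<open>x' \<in> \<Lambda>\<close> by (simp add: code_def)
qed

text \<open>\<open>code_forward\<close> in both directions makes the code agree exactly around
  \<open>u\<close> and \<open>u + l\<close>; the remaining shift from \<open>u + l\<close> to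
  \<open>v\<close> is shorter than \<open>e / 2\<close>.\<close>

lemma alike_imp_code_close:
  assumes "0 < e"
  shows "\<exists>R. \<forall>u v. alike \<Lambda> R u v \<longrightarrow> tiling_dist (translate code u) (translate code v) < e"
proof -
  obtain C where C: "0 \<le> C" "\<And>x. x \<in> \<Lambda> \<Longrightarrow> norm (x - code_pt x) \<le> C"
    using code_pt_bounded by blast
  define e' where "e' = min (e / 2) e0"
  have e': "0 < e'" "e' \<le> e / 2" "e' \<le> e0"
    using assms e0(1) by (auto simp: e'_def)
  obtain R1 where R1: "\<And>u v. alike \<Lambda> R1 u v \<Longrightarrow> \<exists>l\<in>L. norm (v - u - l) < e'"
    using L_near[OF e'(1)] by blast
  define R where "R = max R1 (2 / e + e0 + C + R0)"
  have "tiling_dist (translate code u) (translate code v) < e" if uv: "alike \<Lambda> R u v" for u v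
  proof -
    have "alike \<Lambda> R1 u v"
      using uv by (rule alike_mono) (simp add: R_def)
    then obtain l where l: "l \<in> L" "norm (v - u - l) < e'"
      using R1 by blast
    have l': "norm (v - u - l) < e0" "norm (u - v - (- l)) < e0"
      using l(2) e'(3) norm_minus_commute[of "v - u" l] by (auto simp: algebra_simps)
    have big: "2 / e + e0 + C + R0 \<le> R"
      by (simp add: R_def)
    have "alike code (2 / e) u (u + l)"
      unfolding alike_def
    proof (intro allI impI iffI)
      fix z :: 'a assume z: "norm z \<le> 2 / e"
      show "z + (u + l) \<in> code" if "z + u \<in> code"
        using code_forward[OF C(2) uv l(1) l'(1) that] z big e0(1) by (simp add: add.assoc)
      show "z + u \<in> code" if zl: "z + (u + l) \<in> code"
      proof -
        have "norm (z + (u + l) - v) \<le> norm z + norm (v - u - l)"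
          by (rule norm_le_diff) simp
        then have "norm (z + (u + l) - v) \<le> 2 / e + e0"
          using z l'(1) by linarith
        then show ?thesis
          using code_forward[OF C(2) alike_sym[OF uv] L_uminus[OF l(1)] l'(2) zl] big by (simp add: add.assoc)
      qed
    qed
    then have "tiling_dist (translate code u) (translate code (u + l)) \<le> 1 / (2 / e)"
      using assms by (intro alike_imp_tiling_dist) auto
    moreover have "tiling_dist (translate code (u + l)) (translate code v) \<le> norm (v - u - l)"
      using tiling_dist_translate_self[of "translate code (u + l)" "v - u - l"] by simp
    ultimately show ?thesis
      using tiling_dist_triangle[of "translate code u" "translate code v" "translate code (u + l)"]
        l(2) e'(2) by simp
  qed
  then show ?thesis by blast
qed

text \<open>A lattice point near \<open>u\<close> lands in the code under \<open>v - u\<close>, and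
  one near \<open>v\<close> under \<open>u - v\<close>. So these vectors lie in
  \<open>s1 + L\<close> and \<open>s2 + L\<close>; their sum is zero, hence
  \<open>s1 + s2 \<in> L\<close>, and \<open>Q_add\<close> gives \<open>s1 = 0\<close>.\<close>

lemma code_shift_in_L:
  assumes "alike code R u v" "D \<le> R"
  shows "v - u \<in> L"
proof -
  obtain l where l: "l \<in> L" "norm (l - u) \<le> R"
    using L_dense[of u] assms(2) by (metis norm_minus_commute order_trans)
  then have "l + (v - u) \<in> code"
    using alike_at[OF assms(1), of l] L_subset_code by blast
  then obtain l1 s1 where 1: "l + (v - u) = l1 + s1" "l1 \<in> L" "s1 \<in> Q"
    by (rule code_cases)
  obtain m where m: "m \<in> L" "norm (m - v) \<le> R"
    using L_dense[of v] assms(2) by (metis norm_minus_commute order_trans)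
  then have "m + (u - v) \<in> code"
    using alike_at[OF alike_sym[OF assms(1)], of m] L_subset_code by blast
  then obtain l2 s2 where 2: "m + (u - v) = l2 + s2" "l2 \<in> L" "s2 \<in> Q"
    by (rule code_cases)
  have "s1 = l + (v - u) - l1" "s2 = m + (u - v) - l2"
    using 1(1) 2(1) by (simp_all add: algebra_simps)
  then have "s1 + s2 = (l - l1) + (m - l2)"
    by simp
  then have "s1 + s2 \<in> L"
    using L_add[OF L_diff L_diff] l(1) m(1) 1(2) 2(2) by simp
  then have "s1 = 0"
    using Q_add[of s1 s2] 1(3) 2(3) unfolding Q_def by blast
  then have "v - u = l1 - l"
    using 1(1) by (simp add: algebra_simps)
  then show ?thesis
    using L_diff 1(2) l(1) by simp
qed

text \<open>\<open>Q_diff\<close> recovers the offset and so the colour; as that offset is outside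
  \<open>Q0\<close>, the code point stems from some \<open>x'\<close>. The lattice components differ
  by exactly \<open>w\<close>, and the distances of \<open>x\<close> and \<open>x'\<close> from the
  lattice translate add up to the error \<open>2 * e0\<close>.\<close>

lemma code_decode:
  assumes x: "x \<in> \<Lambda>" and w: "w \<in> L" and code: "code_pt x + w \<in> code"
  obtains x' where "x' \<in> \<Lambda>" "alike \<Lambda> R0 x x'" "norm (x' - x - w) < 2 * e0"
proof -
  obtain l s where ls: "code_pt x + w = l + s" "l \<in> L" "s \<in> Q"
    "s \<in> Q0 \<or> (\<exists>x\<in>\<Lambda>. l = near_lattice x \<and> s = q (colour x))"
    using code by (rule code_cases)
  have qx: "q (colour x) \<in> Q"
    using x by (simp add: Q_def)
  have "s - q (colour x) = near_lattice x + w - l"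
    using ls(1) by (simp add: code_pt_def algebra_simps)
  then have "s - q (colour x) \<in> L"
    using L_diff[OF L_add[OF near_lattice(1)[OF x] w] ls(2)] by simp
  then have s: "s = q (colour x)"
    using Q_diff[of s "q (colour x)"] ls(3) qx unfolding Q_def by blast
  have "s \<notin> Q0"
    using q_Q0[OF x] unfolding s .
  then obtain x' where x': "x' \<in> \<Lambda>" "l = near_lattice x'" "s = q (colour x')"
    using ls(4) by blast
  have "colour x' = colour x"
    using q_inj x x'(1,3) s by (auto dest: inj_onD)
  moreover have "near_lattice x' = near_lattice x + w"
    using ls(1) x'(2) s by (simp add: code_pt_def algebra_simps)
  ultimately have eq: "x' - x - w = (x' - centre (colour x') - near_lattice x') - (x - centre (colour x) - near_lattice x)"
    by simp
  have "norm (x' - x - w) < 2 * e0"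
    unfolding eq using near_lattice(2)[OF x] near_lattice(2)[OF x'(1)]
      norm_triangle_ineq4[of "x' - centre (colour x') - near_lattice x'" "x - centre (colour x) - near_lattice x"]
    by linarith
  then show thesis
    using that x'(1) \<open>colour x' = colour x\<close> centred_patch_eq_iff by metis
qed

text \<open>The decoded displacements are only known up to \<open>2 * e0\<close>, but equal patches around \<open>x\<close> and
  \<open>x'\<close> transport \<open>y\<close> exactly, and uniform discreteness identifies the result with \<open>y'\<close>.\<close>

lemma decoded_shift_locally_constant:
  assumes "x \<in> \<Lambda>" "x' \<in> \<Lambda>" "alike \<Lambda> R0 x x'" "norm (x' - x - w) < 2 * e0"
    and "y \<in> \<Lambda>" "y' \<in> \<Lambda>" "norm (y' - y - w) < 2 * e0" "norm (y - x) \<le> R0"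
  shows "y' - y = x' - x"
proof -
  have "y + (x' - x) \<in> \<Lambda>"
    using alike_at[OF assms(3,8)] assms(5) by blast
  moreover have "norm (y + (x' - x) - y') < r"
  proof -
    have "norm (y + (x' - x) - y') \<le> norm (x' - x - w) + norm (y' - y - w)"
      by (rule norm_le_diff) simp
    then show ?thesis
      using assms(4,7) e0(2) by linarith
  qed
  ultimately have "y + (x' - x) = y'"
    using \<Lambda>_sep assms(6) by blast
  then show ?thesis
    by (simp add: algebra_simps)
qed

text \<open>Go \<open>2 * a\<close> towards \<open>x0\<close> and take a point of the set within
  \<open>a\<close>. The resulting chain has steps of at most \<open>3 * a \<le> R0\<close>, the
  range of \<open>decoded_shift_locally_constant\<close>.\<close>

lemma \<Lambda>_step_towards:
  assumes "x \<in> \<Lambda>" "3 * a < norm (x - x0)"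
  obtains y where "y \<in> \<Lambda>" "norm (y - x0) \<le> norm (x - x0) - a" "norm (x - y) \<le> 3 * a"
proof -
  define d where "d = norm (x - x0)"
  have d: "0 < d" "2 * a \<le> d"
    using assms(2) a_pos by (auto simp: d_def)
  define z where "z = x - (2 * a / d) *\<^sub>R (x - x0)"
  have zx: "norm (x - z) = 2 * a"
    using d a_pos by (simp add: z_def d_def[symmetric])
  have "z - x0 = (1 - 2 * a / d) *\<^sub>R (x - x0)"
    by (simp add: z_def algebra_simps)
  moreover have "0 \<le> 1 - 2 * a / d"
    using d by simp
  ultimately have "norm (z - x0) = (1 - 2 * a / d) * d"
    by (simp add: d_def)
  then have zx0: "norm (z - x0) = d - 2 * a"
    using d(1) by (simp add: algebra_simps)
  obtain y where y: "y \<in> \<Lambda>" "norm (z - y) \<le> a"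
    using \<Lambda>_dense by blast
  have "norm (y - x0) \<le> norm (z - x0) + norm (z - y)"
    by (rule norm_le_diff) simp
  moreover have "norm (x - y) \<le> norm (x - z) + norm (z - y)"
    by (rule norm_le_add) simp
  ultimately have "norm (y - x0) \<le> d - a" "norm (x - y) \<le> 3 * a"
    using zx zx0 y(2) by linarith+
  then show thesis
    using that y(1) by (simp add: d_def)
qed

text \<open>Every point \<open>x\<close> near \<open>u\<close> decodes to some \<open>f x\<close>
  with displacement near \<open>w\<close>. Along chains to \<open>x0\<close> the displacement is
  constant, so it is one vector \<open>k\<close>, and the \<open>R0\<close>-patches at
  \<open>x\<close> and \<open>x + k\<close> glue to a large patch. In the radius, \<open>C\<close>
  covers the coding displacement, \<open>a\<close> the distance from \<open>u\<close> to
  \<open>x0\<close>, \<open>R1 + 3 * a + D\<close> the good points.\<close>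

lemma code_backward:
  assumes C: "0 \<le> C" "\<And>x. x \<in> \<Lambda> \<Longrightarrow> norm (x - code_pt x) \<le> C"
    and uv: "alike code (R1 + C + 4 * a + D) u v" and R1: "0 \<le> R1"
  obtains k where "v - u \<in> L" "norm (k - (v - u)) < 2 * e0" "alike \<Lambda> R1 u (u + k)"
proof -
  define w where "w = v - u"
  have "0 \<le> D"
    using L_dense norm_ge_zero order_trans by blast
  have w: "w \<in> L"
    unfolding w_def using uv by (rule code_shift_in_L) (use C(1) R1 a_pos in linarith)
  obtain x0 where x0: "x0 \<in> \<Lambda>" "norm (u - x0) \<le> a"
    using \<Lambda>_dense by blast
  define good where "good x = (x \<in> \<Lambda> \<and> norm (x - x0) \<le> R1 + 3 * a + D)" for x
  have "\<exists>x'. x' \<in> \<Lambda> \<and> alike \<Lambda> R0 x x' \<and> norm (x' - x - w) < 2 * e0" if "good x" for x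
  proof -
    have x: "x \<in> \<Lambda>" "norm (x - x0) \<le> R1 + 3 * a + D"
      using that by (auto simp: good_def)
    have "code_pt x - u = (x - x0) - (x - code_pt x) - (u - x0)"
      by simp
    then have "norm (code_pt x - u) \<le> norm (x - x0) + norm (x - code_pt x) + norm (u - x0)"
      by (metis (no_types) norm_triangle_ineq4 add_right_mono order_trans)
    then have "norm (code_pt x - u) \<le> R1 + C + 4 * a + D"
      using x(2) C(2)[OF x(1)] x0(2) by linarith
    then have "code_pt x + w \<in> code"
      using alike_at[OF uv, of "code_pt x"] x(1) by (simp add: code_def w_def)
    then show ?thesis
      using code_decode[OF x(1) w] by blast
  qed
  then obtain f where f: "\<And>x. good x \<Longrightarrow> f x \<in> \<Lambda>" "\<And>x. good x \<Longrightarrow> alike \<Lambda> R0 x (f x)"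
    "\<And>x. good x \<Longrightarrow> norm (f x - x - w) < 2 * e0"
    by metis
  have good0: "good x0"
    using x0(1) R1 a_pos \<open>0 \<le> D\<close> by (simp add: good_def)
  define k where "k = f x0 - x0"
  have const: "f y - y = f x - x" if "good x" "good y" "norm (y - x) \<le> R0" for x y
    using that f by (intro decoded_shift_locally_constant[of x "f x" w y "f y"]) (auto simp: good_def)
  \<comment> \<open>Induction on the distance to \<open>x0\<close> in units of \<open>a\<close>;
    each link of the chain gains at least one unit.\<close>
  have k: "f x - x = k" if "good x" "norm (x - x0) \<le> real n * a" for x n
    using that
  proof (induction n arbitrary: x)
    case 0
    then have "x = x0"
      by simp
    then show ?case
      by (simp add: k_def)
  next
    case (Suc n)
    show ?case
    proof (cases "norm (x - x0) \<le> 3 * a")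
      case True
      then show ?thesis
        using const[OF good0 Suc.prems(1)] R0 by (simp add: k_def)
    next
      case False
      then obtain y where y: "y \<in> \<Lambda>" "norm (y - x0) \<le> norm (x - x0) - a" "norm (x - y) \<le> 3 * a"
        using \<Lambda>_step_towards[of x x0] Suc.prems(1) unfolding good_def by auto
      have "good y"
        using y(1,2) Suc.prems(1) a_pos by (simp add: good_def)
      moreover have "norm (y - x0) \<le> real n * a"
        using y(2) Suc.prems(2) by (simp add: algebra_simps)
      ultimately have "f y - y = k"
        using Suc.IH by blast
      then show ?thesis
        using const[OF \<open>good y\<close> Suc.prems(1)] y(3) R0 by simp
    qed
  qed
  have fk: "f x = x + k" if "good x" for x
  proof -
    obtain n :: nat where "norm (x - x0) / a \<le> real n"
      using real_arch_simple by blast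
    then have "norm (x - x0) \<le> real n * a"
      using a_pos by (simp add: field_simps)
    then show ?thesis
      using k[OF that] by (simp add: algebra_simps)
  qed
  have "alike \<Lambda> R1 u (u + k)"
    unfolding alike_def
  proof (intro allI impI)
    fix z :: 'a assume z: "norm z \<le> R1"
    obtain x where x: "x \<in> \<Lambda>" "norm (z + u - x) \<le> a"
      using \<Lambda>_dense by blast
    have "x - x0 = z + (u - x0) - (z + u - x)"
      by simp
    then have "norm (x - x0) \<le> norm z + norm (u - x0) + norm (z + u - x)"
      by (metis (no_types) norm_triangle_ineq4 norm_triangle_ineq add_right_mono order_trans)
    then have "good x"
      using x z x0(2) a_pos \<open>0 \<le> D\<close> by (simp add: good_def)
    then have "alike \<Lambda> R0 x (x + k)"
      using f(2) fk by metis
    then show "z + u \<in> \<Lambda> \<longleftrightarrow> z + (u + k) \<in> \<Lambda>"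
      using alike_at[of \<Lambda> R0 x "x + k" "z + u"] x(2) R0 a_pos by (simp add: add.assoc)
  qed
  moreover have "norm (k - w) < 2 * e0"
    using f(3)[OF good0] by (simp add: k_def)
  ultimately show thesis
    using that w by (simp add: w_def)
qed

text \<open>Decoding yields \<open>k\<close> only within \<open>2 * e0\<close> of
  \<open>v - u\<close>. But \<open>k\<close> joins equal patches of \<open>\<Lambda>\<close>, so
  \<open>L_near\<close> places it within \<open>e'\<close> of some \<open>l \<in> L\<close>, and
  separation forces \<open>l = v - u\<close>: the coarse error improves to
  \<open>e'\<close>.\<close>

lemma code_alike_imp_close:
  assumes "0 < e"
  shows "\<exists>R. \<forall>u v. alike code R u v \<longrightarrow> tiling_dist (translate \<Lambda> u) (translate \<Lambda> v) < e"
proof -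
  obtain C where C: "0 \<le> C" "\<And>x. x \<in> \<Lambda> \<Longrightarrow> norm (x - code_pt x) \<le> C"
    using code_pt_bounded by blast
  define e' where "e' = min (e / 2) e0"
  have e': "0 < e'" "e' \<le> e / 2" "e' \<le> e0"
    using assms e0(1) by (auto simp: e'_def)
  obtain R where R: "\<And>u v. alike \<Lambda> R u v \<Longrightarrow> \<exists>l\<in>L. norm (v - u - l) < e'"
    using L_near[OF e'(1)] by blast
  define R1 where "R1 = max R (2 / e)"
  have R1: "0 \<le> R1"
    using assms by (simp add: R1_def le_max_iff_disj)
  have "tiling_dist (translate \<Lambda> u) (translate \<Lambda> v) < e" if uv: "alike code (R1 + C + 4 * a + D) u v" for u v
  proof -
    obtain k where k: "v - u \<in> L" "norm (k - (v - u)) < 2 * e0" "alike \<Lambda> R1 u (u + k)"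
      using code_backward[OF C uv R1] by blast
    have "alike \<Lambda> R u (u + k)" "alike \<Lambda> (2 / e) u (u + k)"
      using k(3) by (auto intro: alike_mono simp: R1_def)
    then obtain l where l: "l \<in> L" "norm (u + k - u - l) < e'"
      using R by blast
    have "l = v - u"
    proof (rule L_eq[OF l(1) k(1)])
      have "norm (l - (v - u)) \<le> norm (k - (v - u)) + norm (u + k - u - l)"
        by (rule norm_le_diff) simp
      then show "norm (l - (v - u)) < \<rho>"
        using k(2) l(2) e'(3) e0 by linarith
    qed
    then have "v - (u + k) = - (u + k - u - l)"
      by simp
    then have kl: "norm (v - (u + k)) < e'"
      using l(2) by (simp only: norm_minus_cancel)
    have "tiling_dist (translate \<Lambda> u) (translate \<Lambda> (u + k)) \<le> 1 / (2 / e)"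
      using assms \<open>alike \<Lambda> (2 / e) u (u + k)\<close> by (intro alike_imp_tiling_dist) auto
    moreover have "tiling_dist (translate \<Lambda> (u + k)) (translate \<Lambda> v) \<le> norm (v - (u + k))"
      using tiling_dist_translate_self[of "translate \<Lambda> (u + k)" "v - (u + k)"] by simp
    ultimately show ?thesis
      using tiling_dist_triangle[of "translate \<Lambda> u" "translate \<Lambda> v" "translate \<Lambda> (u + k)"]
        kl e'(2) by simp
  qed
  then show ?thesis by blast
qed

lemma conjugate_code:
  assumes "closed \<Lambda>" "closed code"
  shows "topologically_conjugate \<Lambda> code"
  using assms alike_imp_code_close code_alike_imp_close by (rule conjugate_if_alike)

end

section \<open>The coding set is a Meyer set\<close>

definition int_vec :: "'a::euclidean_space set"
  where "int_vec = {x. \<forall>j\<in>Basis. x \<bullet> j \<in> \<int>}"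

lemma int_vec_0: "0 \<in> int_vec"
  by (simp add: int_vec_def)

lemma int_vec_diff: "x \<in> int_vec \<Longrightarrow> y \<in> int_vec \<Longrightarrow> x - y \<in> int_vec"
  by (simp add: int_vec_def inner_diff_left)

lemma int_vec_add: "x \<in> int_vec \<Longrightarrow> y \<in> int_vec \<Longrightarrow> x + y \<in> int_vec"
  by (simp add: int_vec_def inner_add_left)

lemma int_vec_of_nat_scaleR: "x \<in> int_vec \<Longrightarrow> of_nat n *\<^sub>R x \<in> int_vec"
  by (simp add: int_vec_def)

lemma int_vec_Basis: "j \<in> Basis \<Longrightarrow> j \<in> int_vec"
  by (auto simp: int_vec_def inner_Basis)

lemma inner_sum_scaleR_Basis: "k \<in> Basis \<Longrightarrow> (\<Sum>j\<in>Basis. c j *\<^sub>R j) \<bullet> k = c k"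
  for k :: "'a::euclidean_space"
  by simp

lemma int_vec_sum: "(\<Sum>j\<in>Basis. of_int (c j) *\<^sub>R j) \<in> (int_vec :: 'a::euclidean_space set)"
  by (simp add: int_vec_def)

lemma int_vec_norm_ge_1:
  fixes x :: "'a::euclidean_space"
  assumes "x \<in> int_vec" "norm x < 1"
  shows "x = 0"
proof (rule euclidean_eqI)
  fix j :: 'a assume j: "j \<in> Basis"
  then obtain k :: int where k: "x \<bullet> j = of_int k"
    using assms(1) by (auto simp: int_vec_def elim: Ints_cases)
  have "\<bar>x \<bullet> j\<bar> < 1"
    using Basis_le_norm[OF j, of x] assms(2) by linarith
  then show "x \<bullet> j = 0 \<bullet> j"
    using k by simp
qed

lemma group_closure_sum:
  "(\<And>i. i \<in> I \<Longrightarrow> f i \<in> group_closure S) \<Longrightarrow> sum f I \<in> group_closure S"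
  by (induction I rule: infinite_finite_induct) (auto intro: group_closure_add)

lemma group_closure_int_scaleR:
  fixes x :: "'a::real_vector"
  assumes "x \<in> group_closure S"
  shows "of_int k *\<^sub>R x \<in> group_closure S"
proof -
  have nat: "of_nat n *\<^sub>R x \<in> group_closure S" for n
    by (induction n) (auto simp: scaleR_add_left intro: group_closure_add assms)
  show ?thesis
  proof (cases "0 \<le> k")
    case True
    then show ?thesis
      using nat[of "nat k"] by simp
  next
    case False
    then have "of_int k *\<^sub>R x = - (of_nat (nat (- k)) *\<^sub>R x)"
      by simp
    then show ?thesis
      using nat[of "nat (- k)"] by simp
  qed
qed

text \<open>A character is determined by its values on a lattice basis, and a functional can match
  those exactly, so the error on \<open>A\<close> is zero. By \<open>gen\<close> the basis lies in
  the group on which \<open>\<phi>\<close> is known to be a homomorphism.\<close>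

lemma harmonious_in_lattice:
  fixes A :: "'a::euclidean_space set" and G B :: "'a \<Rightarrow> 'a"
  assumes lin: "linear G" "linear B" and BG: "\<And>x. B (G x) = x"
    and sub: "A \<subseteq> G ` int_vec" and gen: "G ` Basis \<subseteq> A"
  shows "harmonious A"
  unfolding harmonious_def circ_def[symmetric]
proof (intro allI impI, elim conjE)
  fix \<phi> :: "'a \<Rightarrow> complex" and \<epsilon> :: real
  assume unit: "\<forall>a\<in>group_closure A. \<phi> a \<in> sphere 0 1"
    and hom: "\<forall>a\<in>group_closure A. \<forall>b\<in>group_closure A. \<phi> (a + b) = \<phi> a * \<phi> b" and "0 < \<epsilon>"
  have "\<exists>y. \<phi> (G j) = circ y" if "j \<in> Basis" for j
  proof -
    have "G j \<in> group_closure A"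
      using gen that by (intro group_closure.base) auto
    then have "norm (\<phi> (G j)) = 1"
      using unit by auto
    then have "\<phi> (G j) = circ (Arg2pi (\<phi> (G j)) / (2 * pi))"
      unfolding complex_norm_eq_1_exp circ_eq by simp
    then show ?thesis ..
  qed
  then obtain y where y: "\<And>j. j \<in> Basis \<Longrightarrow> \<phi> (G j) = circ (y j)"
    by metis
  define b where "b = (\<Sum>j\<in>Basis. y j *\<^sub>R j)"
  have bl: "bounded_linear (\<lambda>x. b \<bullet> B x)"
    using lin(2) by (intro bounded_linear_compose[OF bounded_linear_inner_right]) (simp add: linear_linear)
  define \<beta> where "\<beta> = Blinfun (\<lambda>x. b \<bullet> B x)"
  have \<beta>: "\<beta> x = b \<bullet> B x" for x
    unfolding \<beta>_def by (simp add: bounded_linear_Blinfun_apply[OF bl])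
  have eq: "a \<in> group_closure A \<and> \<phi> a = circ (\<beta> a)" if "a \<in> group_closure (G ` Basis)" for a
    using that
  proof induction
    case (base s)
    show ?case
    proof (cases "s = 0")
      case True
      have "\<phi> 0 * \<phi> 0 = \<phi> 0" "\<phi> 0 \<noteq> 0"
        using hom[rule_format, of 0 0] unit[rule_format, of 0] by auto
      then show ?thesis
        using True by (simp add: circ_def)
    next
      case False
      then obtain j where j: "j \<in> Basis" "s = G j"
        using base by auto
      then have "\<beta> s = y j"
        by (simp add: \<beta> BG b_def inner_sum_scaleR_Basis)
      then show ?thesis
        using y j gen by (auto intro: group_closure.base)
    qed
  next
    case (diff s t)
    then have st: "s - t \<in> group_closure A"
      by (blast intro: group_closure.diff)
    then have "\<phi> s = \<phi> (s - t) * \<phi> t"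
      using hom[rule_format, of "s - t" t] diff by simp
    then have "\<phi> (s - t) = circ (\<beta> (s - t))"
      using diff by (simp add: blinfun.diff_right circ_diff)
    with st show ?case ..
  qed
  have "G ` int_vec \<subseteq> group_closure (G ` Basis)"
  proof safe
    fix x :: 'a assume x: "x \<in> int_vec"
    have "G x = G (\<Sum>j\<in>Basis. (x \<bullet> j) *\<^sub>R j)"
      by (simp add: euclidean_representation)
    also have "\<dots> = (\<Sum>j\<in>Basis. (x \<bullet> j) *\<^sub>R G j)"
      using lin(1) by (simp add: linear_sum linear_scale)
    also have "\<dots> \<in> group_closure (G ` Basis)"
    proof (rule group_closure_sum)
      fix j :: 'a assume j: "j \<in> Basis"
      then obtain k :: int where k: "x \<bullet> j = of_int k"
        using x by (auto simp: int_vec_def elim: Ints_cases)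
      show "(x \<bullet> j) *\<^sub>R G j \<in> group_closure (G ` Basis)"
        unfolding k using j by (intro group_closure_int_scaleR group_closure.base) simp
    qed
    finally show "G x \<in> group_closure (G ` Basis)" .
  qed
  then have "\<phi> a = circ (\<beta> a)" if "a \<in> A" for a
    using that sub eq by blast
  then show "\<exists>\<beta> :: 'a \<Rightarrow>\<^sub>L real. \<forall>a\<in>A. norm (\<phi> a - circ (\<beta> a)) < \<epsilon>"
    using \<open>0 < \<epsilon>\<close> by (intro exI[of _ \<beta>]) simp
qed

section \<open>Finitely many colours and the lattice of the eigenvalues\<close>

text \<open>\<open>FLC\<close> allows arbitrary translations, while colours remember the centre. The
  centre corresponds to a point of the representative \<open>P\<close>, which is finite by uniform
  discreteness, so each \<open>P\<close> yields finitely many colours.\<close>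

lemma finite_centred_patches:
  fixes A :: "'a::euclidean_space set"
  assumes "FLC A" "uniform_discrete A" "0 < R"
  shows "finite (centred_patch A R ` A)"
proof -
  obtain F where F: "finite F" "\<And>x. x \<in> A \<Longrightarrow> \<exists>P\<in>F. \<exists>t. patch A R x = translate P t"
    using assms(1,3) unfolding FLC_def by meson
  have fin: "finite (patch A R x)" for x
  proof -
    have "uniform_discrete (patch A R x)"
      using assms(2) by (rule uniform_discrete_subset) (simp add: patch_def)
    moreover have "bounded (patch A R x)"
      by (simp add: patch_def bounded_Int)
    ultimately show ?thesis
      using uniform_discrete_finite_iff by blast
  qed
  have "centred_patch A R ` A \<subseteq> (\<Union>P\<in>{P\<in>F. finite P}. translate P ` P)"
  proof safe
    fix x assume x: "x \<in> A"
    then obtain P t where P: "P \<in> F" "patch A R x = translate P t"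
      using F(2) by blast
    have "P = translate (patch A R x) (- t)"
      by (simp add: P(2))
    then have "finite P"
      using fin[of x] by (metis translate_def finite_imageI)
    have "x \<in> patch A R x"
      using x assms(3) by (simp add: patch_def)
    then have "x + t \<in> P"
      by (simp add: P(2) mem_translate_iff)
    moreover have "centred_patch A R x = translate (patch A R x) x"
      by (auto simp: centred_patch_def patch_def mem_translate_iff dist_norm)
    then have "centred_patch A R x = translate P (x + t)"
      by (simp add: P(2) add.commute)
    ultimately show "centred_patch A R x \<in> (\<Union>P\<in>{P\<in>F. finite P}. translate P ` P)"
      using P(1) \<open>finite P\<close> by blast
  qed
  moreover have "finite (\<Union>P\<in>{P\<in>F. finite P}. translate P ` P)"
    using F(1) by auto
  ultimately show ?thesis
    by (rule finite_subset)
qed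

text \<open>\<open>B\<close> has \<open>d\<close> independent eigenvalues as coordinates and
  \<open>G\<close> is its inverse. The image of \<open>int_vec\<close> under \<open>G\<close> is
  thus the lattice on which all these eigenvalues are integral.\<close>

lemma eigenvalue_coordinates:
  fixes A :: "'a::euclidean_space set"
  assumes "has_full_rank_eigenvalues A"
  obtains B G :: "'a \<Rightarrow> 'a" where
    "\<And>j. j \<in> Basis \<Longrightarrow> \<exists>\<beta>. topological_eigenvalue A \<beta> \<and> (\<forall>x. blinfun_apply \<beta> x = B x \<bullet> j)"
    "linear B" "linear G" "\<And>x. B (G x) = x" "\<And>x. G (B x) = x"
proof -
  obtain S where S: "S \<subseteq> Collect (topological_eigenvalue A)" "independent S" "finite S" "card S = DIM('a)"
    using assms unfolding has_full_rank_eigenvalues_def by blast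
  obtain \<beta> :: "'a \<Rightarrow> 'a \<Rightarrow>\<^sub>L real" where \<beta>: "bij_betw \<beta> Basis S"
    using finite_same_card_bij[of "Basis :: 'a set" S] S by auto
  have ind: "independent (vec_of ` S)"
    using real_vector.linear_independent_injective_image[OF linear_vec_of S(2)] inj_on_subset[OF inj_vec_of, of "span S"]
    by blast
  have card: "card (vec_of ` S) = DIM('a)"
    using S(4) card_image[OF inj_on_subset[OF inj_vec_of, of S]] by simp
  have sp: "span (vec_of ` S) = UNIV"
    using card_eq_dim[of "vec_of ` S" UNIV] ind card S(3) by (auto simp: dim_UNIV)
  define B where "B x = (\<Sum>j\<in>Basis. \<beta> j x *\<^sub>R j)" for x
  have Bj: "B x \<bullet> j = \<beta> j x" if "j \<in> Basis" for x j
    using that by (simp add: B_def)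
  have linB: "linear B"
    by (rule linearI) (simp_all add: B_def blinfun.add_right scaleR_add_left sum.distrib
        blinfun.scaleR_right scaleR_sum_right)
  have "inj B"
    unfolding linear_injective_0[OF linB]
  proof (intro allI impI)
    fix x assume "B x = 0"
    then have "\<beta> j x = 0" if "j \<in> Basis" for j
      using Bj[OF that, of x] by simp
    then have "\<forall>\<gamma>\<in>S. blinfun_apply \<gamma> x = 0"
      using \<beta> by (auto simp: bij_betw_def)
    then have "x \<bullet> y = 0" if "y \<in> vec_of ` S" for y
      using that by (auto simp: blinfun_apply_eq_inner inner_commute)
    then have "orthogonal x x"
      using orthogonal_to_span[of x "vec_of ` S" x] sp by (simp add: orthogonal_def)
    then show "x = 0"
      by (simp add: orthogonal_def)
  qed
  then obtain G where G: "linear G" "G \<circ> B = id"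
    using linear_injective_left_inverse[OF linB] by blast
  have "surj B"
    using linB \<open>inj B\<close> by (rule linear_injective_imp_surjective) simp
  have GB: "G (B x) = x" for x
    using G(2) by (simp add: fun_eq_iff)
  have BG: "B (G x) = x" for x
    using \<open>surj B\<close> GB by (metis surjD)
  show thesis
  proof (rule that[OF _ linB G(1) BG GB])
    fix j :: 'a assume j: "j \<in> Basis"
    then have "\<beta> j \<in> S"
      using \<beta> by (auto simp: bij_betw_def)
    then show "\<exists>\<beta>. topological_eigenvalue A \<beta> \<and> (\<forall>x. blinfun_apply \<beta> x = B x \<bullet> j)"
      using S(1) Bj[OF j] by auto
  qed
qed

lemma returns_near_lattice:
  fixes A :: "'a::euclidean_space set" and G B :: "'a \<Rightarrow> 'a"
  assumes "linear B" "linear G" and GB: "\<And>x. G (B x) = x"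
    and near: "\<And>j. j \<in> Basis \<Longrightarrow> returns_near_int A (\<lambda>x. B x \<bullet> j)" and "0 < e"
  shows "\<exists>R. \<forall>u v. alike A R u v \<longrightarrow> (\<exists>l\<in>G ` int_vec. norm (v - u - l) < e)"
proof -
  obtain K where K: "0 < K" "\<And>x. norm (G x) \<le> K * norm x"
    using linear_bounded_pos[OF assms(2)] by blast
  \<comment> \<open>Each of the \<open>d\<close> coordinates contributes at most
    \<open>\<eta>\<close> and \<open>G\<close> stretches by at most \<open>K\<close>; the
    \<open>2\<close> makes the final estimate strict.\<close>
  define \<eta> where "\<eta> = e / (2 * K * DIM('a))"
  have \<eta>: "0 < \<eta>"
    using K(1) \<open>0 < e\<close> by (simp add: \<eta>_def)
  have "\<forall>j\<in>Basis. \<exists>R. \<forall>u v. alike A R u v \<longrightarrow> (\<exists>n::int. \<bar>B (v - u) \<bullet> j - of_int n\<bar> < \<eta>)"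
    using near \<eta> unfolding returns_near_int_def by blast
  then obtain R where R: "\<And>j u v. j \<in> Basis \<Longrightarrow> alike A (R j) u v \<Longrightarrow> \<exists>n::int. \<bar>B (v - u) \<bullet> j - of_int n\<bar> < \<eta>"
    by metis
  have "\<exists>l\<in>G ` int_vec. norm (v - u - l) < e" if uv: "alike A (\<Sum>j\<in>Basis. \<bar>R j\<bar>) u v" for u v
  proof -
    have "\<exists>n::int. \<bar>B (v - u) \<bullet> j - of_int n\<bar> < \<eta>" if j: "j \<in> Basis" for j
    proof (rule R[OF j alike_mono[OF uv]])
      have "\<bar>R j\<bar> \<le> (\<Sum>j\<in>Basis. \<bar>R j\<bar>)"
        using j by (intro member_le_sum) auto
      then show "R j \<le> (\<Sum>j\<in>Basis. \<bar>R j\<bar>)"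
        by linarith
    qed
    then obtain n :: "'a \<Rightarrow> int" where n: "\<And>j. j \<in> Basis \<Longrightarrow> \<bar>B (v - u) \<bullet> j - of_int (n j)\<bar> < \<eta>"
      by metis
    define m where "m = (\<Sum>j\<in>Basis. of_int (n j) *\<^sub>R j :: 'a)"
    have mj: "m \<bullet> j = of_int (n j)" if "j \<in> Basis" for j
      using that by (simp add: m_def)
    have "norm (B (v - u) - m) \<le> (\<Sum>j\<in>Basis. \<bar>(B (v - u) - m) \<bullet> j\<bar>)"
      by (rule norm_le_l1)
    also have "\<dots> \<le> (\<Sum>j\<in>(Basis :: 'a set). \<eta>)"
      using n mj by (intro sum_mono) (auto simp: inner_diff_left intro: less_imp_le)
    finally have "norm (B (v - u) - m) \<le> DIM('a) * \<eta>"
      by simp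
    then have "K * norm (B (v - u) - m) \<le> K * (DIM('a) * \<eta>)"
      using K(1) by (intro mult_left_mono) auto
    also have "\<dots> = e / 2"
      using K(1) by (simp add: \<eta>_def)
    finally have "K * norm (B (v - u) - m) \<le> e / 2" .
    moreover have "v - u - G m = G (B (v - u) - m)"
      using assms(2) GB by (simp add: linear_diff)
    ultimately have "norm (v - u - G m) < e"
      using K(2)[of "B (v - u) - m"] \<open>0 < e\<close> by simp
    then show ?thesis
      using imageI[OF int_vec_sum[of n], of G] unfolding m_def by blast
  qed
  then show ?thesis by blast
qed

lemma lattice_separated:
  fixes B G :: "'a::euclidean_space \<Rightarrow> 'a"
  assumes "linear B" and BG: "\<And>x. B (G x) = x" and G0: "G 0 = 0"
  obtains \<rho> where "0 < \<rho>" "\<And>l. l \<in> G ` int_vec \<Longrightarrow> norm l < \<rho> \<Longrightarrow> l = 0"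
proof -
  obtain K where K: "0 < K" "\<And>x. norm (B x) \<le> K * norm x"
    using linear_bounded_pos[OF assms(1)] by blast
  show thesis
  proof (rule that[of "1 / K"])
    fix l assume l: "l \<in> G ` int_vec" "norm l < 1 / K"
    then obtain n where n: "n \<in> int_vec" "l = G n"
      by blast
    have "norm n \<le> K * norm l"
      using K(2)[of l] BG n(2) by simp
    also have "\<dots> < 1"
      using l(2) K(1) by (simp add: field_simps)
    finally have "n = 0"
      using int_vec_norm_ge_1 n(1) by blast
    then show "l = 0"
      using n(2) G0 by simp
  qed (use K in simp)
qed

lemma lattice_dense:
  fixes B G :: "'a::euclidean_space \<Rightarrow> 'a"
  assumes "linear G" and GB: "\<And>x. G (B x) = x"
  obtains D where "0 < D" "\<And>x. \<exists>l\<in>G ` int_vec. norm (x - l) \<le> D"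
proof -
  obtain K where K: "0 < K" "\<And>x. norm (G x) \<le> K * norm x"
    using linear_bounded_pos[OF assms(1)] by blast
  have "\<exists>l\<in>G ` int_vec. norm (x - l) \<le> K * DIM('a)" for x
  proof -
    define m where "m = (\<Sum>j\<in>Basis. of_int \<lfloor>B x \<bullet> j\<rfloor> *\<^sub>R j :: 'a)"
    have "norm (B x - m) \<le> (\<Sum>j\<in>Basis. \<bar>(B x - m) \<bullet> j\<bar>)"
      by (rule norm_le_l1)
    also have "\<dots> \<le> (\<Sum>j\<in>(Basis :: 'a set). 1)"
    proof (rule sum_mono)
      fix j :: 'a assume "j \<in> Basis"
      then have "(B x - m) \<bullet> j = B x \<bullet> j - of_int \<lfloor>B x \<bullet> j\<rfloor>"
        by (simp add: m_def inner_diff_left)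
      then show "\<bar>(B x - m) \<bullet> j\<bar> \<le> 1"
        by linarith
    qed
    finally have "K * norm (B x - m) \<le> K * DIM('a)"
      using K(1) by (intro mult_left_mono) auto
    moreover have "x - G m = G (B x - m)"
      using assms by (simp add: linear_diff)
    ultimately have "norm (x - G m) \<le> K * DIM('a)"
      using K(2)[of "B x - m"] by simp
    then show ?thesis
      using imageI[OF int_vec_sum[of "\<lambda>j. \<lfloor>B x \<bullet> j\<rfloor>"], of G] unfolding m_def by blast
  qed
  moreover have "0 < K * DIM('a)"
    using K(1) by simp
  ultimately show thesis
    using that by blast
qed

text \<open>Used with \<open>2 * K < N\<close>: sums and differences of vectors in this box that are divisible by \<open>N\<close>
  vanish.\<close>

definition small_int_vec :: "real \<Rightarrow> 'a::euclidean_space set"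
  where "small_int_vec K = {x \<in> int_vec. \<forall>j\<in>Basis. 0 \<le> x \<bullet> j \<and> x \<bullet> j \<le> K}"

lemma of_int_multiple_bounded:
  fixes N :: real
  assumes "x = N * y" "y \<in> \<int>" "\<bar>x\<bar> < N"
  shows "x = 0"
proof -
  obtain k :: int where k: "y = of_int k"
    using assms(2) by (rule Ints_cases)
  have "0 < N"
    using assms(3) by linarith
  then have "\<bar>of_int k\<bar> < (1 :: real)"
    using assms(1,3) k by (simp add: abs_mult)
  then have "k = 0"
    by linarith
  then show ?thesis
    using assms(1) k by simp
qed

lemma small_int_vec_add:
  fixes s t :: "'a::euclidean_space"
  assumes "s \<in> small_int_vec K" "t \<in> small_int_vec K" "s + t = N *\<^sub>R n" "n \<in> int_vec" "2 * K < N"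
  shows "s = 0"
proof (rule euclidean_eqI)
  fix j :: 'a assume j: "j \<in> Basis"
  have "0 \<le> s \<bullet> j" "s \<bullet> j \<le> K" "0 \<le> t \<bullet> j" "t \<bullet> j \<le> K"
    using assms(1,2) j by (auto simp: small_int_vec_def)
  moreover have "s \<bullet> j + t \<bullet> j = 0"
  proof (rule of_int_multiple_bounded)
    show "s \<bullet> j + t \<bullet> j = N * (n \<bullet> j)"
      using assms(3) by (metis inner_add_left inner_scaleR_left)
    show "n \<bullet> j \<in> \<int>"
      using assms(4) j by (simp add: int_vec_def)
  qed (use calculation assms(5) in linarith)
  ultimately show "s \<bullet> j = 0 \<bullet> j"
    by simp
qed

lemma small_int_vec_diff:
  fixes s t :: "'a::euclidean_space"
  assumes "s \<in> small_int_vec K" "t \<in> small_int_vec K" "s - t = N *\<^sub>R n" "n \<in> int_vec" "2 * K < N"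
  shows "s = t"
proof (rule euclidean_eqI)
  fix j :: 'a assume j: "j \<in> Basis"
  have "0 \<le> s \<bullet> j" "s \<bullet> j \<le> K" "0 \<le> t \<bullet> j" "t \<bullet> j \<le> K"
    using assms(1,2) j by (auto simp: small_int_vec_def)
  moreover have "s \<bullet> j - t \<bullet> j = 0"
  proof (rule of_int_multiple_bounded)
    show "s \<bullet> j - t \<bullet> j = N * (n \<bullet> j)"
      using assms(3) by (metis inner_diff_left inner_scaleR_left)
    show "n \<bullet> j \<in> \<int>"
      using assms(4) j by (simp add: int_vec_def)
  qed (use calculation assms(5) in linarith)
  ultimately show "s \<bullet> j = t \<bullet> j"
    by simp
qed

section \<open>Choice of the constants and offsets of the coding\<close>

lemma meyer_conjugate_if_full_rank:
  fixes A :: "'a::euclidean_space set"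
  assumes A: "delone A" "FLC A" "recurrent A" and full: "has_full_rank_eigenvalues A"
  shows "\<exists>A'. meyer A' \<and> topologically_conjugate A A'"
proof -
  have ud: "uniform_discrete A" and rd: "relatively_dense A"
    using A(1) by (auto simp: delone_def)
  have closedA: "closed A"
    using ud by (rule uniform_discrete_imp_closed)
  obtain B G :: "'a \<Rightarrow> 'a" where
    eig: "\<And>j. j \<in> Basis \<Longrightarrow> \<exists>\<beta>. topological_eigenvalue A \<beta> \<and> (\<forall>x. blinfun_apply \<beta> x = B x \<bullet> j)"
    and lin: "linear B" "linear G" and BG: "\<And>x. B (G x) = x" and GB: "\<And>x. G (B x) = x"
    using eigenvalue_coordinates[OF full] by metis
  have G0: "G 0 = 0"
    using lin(2) by (rule linear_0)
  have Ginj: "G x = G y \<longleftrightarrow> x = y" for x y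
    using BG by metis
  have near: "returns_near_int A (\<lambda>x. B x \<bullet> j)" if j: "j \<in> Basis" for j
  proof -
    obtain \<beta> where \<beta>: "topological_eigenvalue A \<beta>" "\<forall>x. blinfun_apply \<beta> x = B x \<bullet> j"
      using eig[OF j] by blast
    then have "blinfun_apply \<beta> = (\<lambda>x. B x \<bullet> j)"
      by blast
    then show ?thesis
      using returns_near_int_if_eigenvalue[OF closedA A(3) \<beta>(1)] by simp
  qed
  define L where "L = G ` int_vec"
  have L_near: "\<exists>R. \<forall>u v. alike A R u v \<longrightarrow> (\<exists>l\<in>L. norm (v - u - l) < e)" if "0 < e" for e
    unfolding L_def using returns_near_lattice[OF lin GB near that] .
  obtain \<rho> where \<rho>: "0 < \<rho>" "\<And>l. l \<in> L \<Longrightarrow> norm l < \<rho> \<Longrightarrow> l = 0"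
    using lattice_separated[OF lin(1) BG G0] unfolding L_def by blast
  obtain D where D: "0 < D" "\<And>x. \<exists>l\<in>L. norm (x - l) \<le> D"
    using lattice_dense[OF lin(2) GB] unfolding L_def by blast
  obtain r where r: "0 < r" "\<And>x y. x \<in> A \<Longrightarrow> y \<in> A \<Longrightarrow> norm (x - y) < r \<Longrightarrow> x = y"
    using ud unfolding uniform_discrete_def dist_norm by blast
  obtain a where a: "0 < a" "\<And>x. \<exists>y\<in>A. norm (x - y) \<le> a"
    using rd unfolding relatively_dense_def dist_norm by blast
  \<comment> \<open>Accumulated coding and decoding errors reach at most \<open>4 * e0\<close>,
    which must not exceed either separation constant.\<close>
  define e0 where "e0 = min r \<rho> / 4"
  have e0: "0 < e0" "4 * e0 \<le> r" "4 * e0 \<le> \<rho>"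
    using r(1) \<rho>(1) by (auto simp: e0_def)
  obtain R1 where R1: "\<And>u v. alike A R1 u v \<Longrightarrow> \<exists>l\<in>L. norm (v - u - l) < e0"
    using L_near[OF e0(1)] by blast
  \<comment> \<open>Colours must be large enough to tie displacements to \<open>L\<close> within
    \<open>e0\<close> and to reach the next point of a chain.\<close>
  define R0 where "R0 = max R1 (3 * a)"
  define \<C> where "\<C> = centred_patch A R0 ` A"
  have "0 < R0"
    using a(1) by (simp add: R0_def less_max_iff_disj)
  then have fin: "finite \<C>"
    unfolding \<C>_def by (intro finite_centred_patches A(2) ud)
  define n where "n = card \<C>"
  obtain i where i: "bij_betw i \<C> {0..<n}"
    using ex_bij_betw_finite_nat[OF fin] unfolding n_def by blast
  define e :: 'a where "e = (SOME j. j \<in> Basis)"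
  have e: "e \<in> Basis"
    unfolding e_def by (rule someI_ex) (use nonempty_Basis in blast)
  \<comment> \<open>Bounds the coordinates of all offsets: the largest multiple of \<open>e\<close>
    is \<open>i c + 2\<close> with \<open>i c < n\<close>. The choice \<open>N = 2 * K + 1\<close>
    below keeps sums and differences of offsets from wrapping around modulo
    \<open>N\<close>.\<close>
  define K where "K = real (n + 1)"
  define N where "N = 2 * n + 3"
  have KN: "2 * K < real N"
    by (simp add: K_def N_def)
  \<comment> \<open>\<open>H\<close> parametrises the finer lattice, \<open>L\<close> scaled by
    \<open>1 / N\<close>.\<close>
  define H where "H x = G ((1 / real N) *\<^sub>R x)" for x
  have linH: "linear H"
    unfolding H_def using lin(2) by (intro linearI) (simp_all add: linear_add linear_scale scaleR_add_right)
  have GH: "G x = H (real N *\<^sub>R x)" for x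
    by (simp add: H_def N_def)
  have Hinj: "H x = H y \<longleftrightarrow> x = y" for x y
    unfolding H_def Ginj by (simp add: N_def)
  define Q0 where "Q0 = H ` insert 0 Basis"
  \<comment> \<open>Multiples starting at \<open>2\<close> avoid \<open>0\<close> and the basis
    vectors, which are taken by \<open>Q0\<close>.\<close>
  define q where "q c = H (real (i c + 2) *\<^sub>R e)" for c
  have small: "Q0 \<union> q ` \<C> \<subseteq> H ` small_int_vec K"
  proof -
    have "insert 0 Basis \<subseteq> (small_int_vec K :: 'a set)"
      by (auto simp: small_int_vec_def int_vec_0 int_vec_Basis inner_Basis K_def)
    moreover have "real (i c + 2) *\<^sub>R e \<in> small_int_vec K" if "c \<in> \<C>" for c
    proof -
      have "i c < n"
        using i that by (auto simp: bij_betw_def)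
      then have "real (i c + 2) \<le> K"
        by (simp add: K_def)
      then show ?thesis
        using e int_vec_of_nat_scaleR[OF int_vec_Basis[OF e], of "i c + 2"]
        by (auto simp: small_int_vec_def inner_Basis)
    qed
    ultimately show ?thesis
      unfolding Q0_def q_def by blast
  qed
  interpret lattice_coding A L Q0 q \<rho> D r a R0 e0
  proof
    show "0 \<in> L"
      unfolding L_def using int_vec_0 G0 by force
    show "x - y \<in> L" if xy: "x \<in> L" "y \<in> L" for x y
    proof -
      obtain x' y' where "x = G x'" "y = G y'" "x' \<in> int_vec" "y' \<in> int_vec"
        using xy unfolding L_def by blast
      then show ?thesis
        unfolding L_def using int_vec_diff linear_diff[OF lin(2), of x' y'] by (metis imageI)
    qed
    show "3 * a \<le> R0"
      by (simp add: R0_def)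
    show "\<exists>l\<in>L. norm (v - u - l) < e0" if "alike A R0 u v" for u v
      using R1 alike_mono[OF that] by (simp add: R0_def)
    show "finite Q0"
      by (simp add: Q0_def)
    show "0 \<in> Q0"
      using linear_0[OF linH] by (force simp: Q0_def)
    show "finite (centred_patch A R0 ` A)"
      using fin by (simp add: \<C>_def)
    show "inj_on q (centred_patch A R0 ` A)"
    proof (rule inj_onI)
      fix c d assume "c \<in> centred_patch A R0 ` A" "d \<in> centred_patch A R0 ` A" "q c = q d"
      moreover from this have "i c = i d"
        using e unfolding q_def Hinj by auto
      ultimately show "c = d"
        using i by (auto simp: bij_betw_def \<C>_def dest: inj_onD)
    qed
    show "q (centred_patch A R0 x) \<notin> Q0" if "x \<in> A" for x
    proof
      assume "q (centred_patch A R0 x) \<in> Q0"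
      then have "real (i (centred_patch A R0 x) + 2) *\<^sub>R e \<in> insert 0 Basis"
        unfolding Q0_def q_def using Hinj by auto
      moreover have "norm v \<le> 1" if "v \<in> insert 0 Basis" for v :: 'a
        using that by auto
      ultimately have "norm (real (i (centred_patch A R0 x) + 2) *\<^sub>R e) \<le> 1"
        by blast
      then show False
        using e by simp
    qed
    show "s = 0" if st: "s \<in> Q0 \<union> q ` centred_patch A R0 ` A" "t \<in> Q0 \<union> q ` centred_patch A R0 ` A" "s + t \<in> L" for s t
    proof -
      obtain s' t' m where *: "s = H s'" "t = H t'" "s' \<in> small_int_vec K" "t' \<in> small_int_vec K"
        "s + t = G m" "m \<in> int_vec"
        using st small unfolding \<C>_def L_def by blast
      have "s' + t' = real N *\<^sub>R m"
        using *(1,2,5) unfolding GH by (metis Hinj linear_add[OF linH])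
      then show ?thesis
        using small_int_vec_add[OF *(3,4) _ *(6) KN] *(1) linear_0[OF linH] by simp
    qed
    show "s = t" if st: "s \<in> Q0 \<union> q ` centred_patch A R0 ` A" "t \<in> Q0 \<union> q ` centred_patch A R0 ` A" "s - t \<in> L" for s t
    proof -
      obtain s' t' m where *: "s = H s'" "t = H t'" "s' \<in> small_int_vec K" "t' \<in> small_int_vec K"
        "s - t = G m" "m \<in> int_vec"
        using st small unfolding \<C>_def L_def by blast
      have "s' - t' = real N *\<^sub>R m"
        using *(1,2,5) unfolding GH by (metis Hinj linear_diff[OF linH])
      then show ?thesis
        using small_int_vec_diff[OF *(3,4) _ *(6) KN] *(1,2) by simp
    qed
  qed (use \<rho> D r a e0 L_near in auto)
  have "harmonious code"
  proof (rule harmonious_in_lattice[of H "\<lambda>x. real N *\<^sub>R B x"])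
    show "linear H"
      by (rule linH)
    show "linear (\<lambda>x. real N *\<^sub>R B x)"
      using lin(1) by (rule linear_compose_scale_right)
    show "real N *\<^sub>R B (H x) = x" for x
      by (simp add: H_def BG N_def)
    show "code \<subseteq> H ` int_vec"
    proof
      fix y assume "y \<in> code"
      then obtain l s where ls: "y = l + s" "l \<in> L" "s \<in> Q"
        by (rule code_cases)
      then obtain m s' where ms: "l = H (real N *\<^sub>R m)" "m \<in> int_vec" "s = H s'" "s' \<in> int_vec"
        using small unfolding L_def Q_def \<C>_def small_int_vec_def GH by blast
      have "y = H (real N *\<^sub>R m + s')"
        using ls(1) ms(1,3) linear_add[OF linH] by simp
      then show "y \<in> H ` int_vec"
        using int_vec_add[OF int_vec_of_nat_scaleR[OF ms(2)] ms(4)] by blast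
    qed
    show "H ` Basis \<subseteq> code"
    proof safe
      fix j :: 'a assume "j \<in> Basis"
      then have "0 + H j \<in> {l + s | l s. l \<in> L \<and> s \<in> Q0}"
        using L_zero unfolding Q0_def by blast
      then show "H j \<in> code"
        by (simp add: code_def)
    qed
  qed
  moreover have "relatively_dense code"
    unfolding relatively_dense_def dist_norm using D L_subset_code by blast
  ultimately have "meyer code"
    by (simp add: meyer_def)
  then show ?thesis
    using conjugate_code[OF closedA closed_if_meyer] by blast
qed

theorem theorem1p1:
  shows "(\<forall>\<Lambda> :: 'a::euclidean_space set. delone \<Lambda> \<and> FLC \<Lambda> \<and> repetitive \<Lambda> \<longrightarrow>
           (has_full_rank_eigenvalues \<Lambda> \<longleftrightarrow>
            (\<exists>\<Lambda>' :: 'a set. meyer \<Lambda>' \<and> topologically_conjugate \<Lambda> \<Lambda>'))) \<and>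
         (\<forall>\<Lambda> :: 'a set. meyer \<Lambda> \<and> repetitive \<Lambda> \<longrightarrow> has_full_rank_eigenvalues \<Lambda>)"
proof (intro conjI allI impI)
  fix \<Lambda> :: "'a set" assume \<Lambda>: "delone \<Lambda> \<and> FLC \<Lambda> \<and> repetitive \<Lambda>"
  then have "\<Lambda> \<noteq> {}"
    by (auto simp: delone_def relatively_dense_def)
  then have "recurrent \<Lambda>"
    using \<Lambda> repetitive_imp_recurrent by blast
  moreover have "closed \<Lambda>"
    using \<Lambda> uniform_discrete_imp_closed by (auto simp: delone_def)
  ultimately show "has_full_rank_eigenvalues \<Lambda> \<longleftrightarrow>
      (\<exists>\<Lambda>' :: 'a set. meyer \<Lambda>' \<and> topologically_conjugate \<Lambda> \<Lambda>')"
    using \<Lambda> meyer_conjugate_if_full_rank full_rank_if_conjugate_meyer by blast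
next
  fix \<Lambda> :: "'a set" assume \<Lambda>: "meyer \<Lambda> \<and> repetitive \<Lambda>"
  then have "\<Lambda> \<noteq> {}"
    by (auto simp: meyer_def relatively_dense_def)
  then show "has_full_rank_eigenvalues \<Lambda>"
    using \<Lambda> meyer_recurrent_full_rank repetitive_imp_recurrent by blast
qed

end
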